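(* Let $A=(a_{ij})$ be an indecomposable $n\times n$ generalised Cartan matrix such that every column of $A$ contains an odd entry, and let $F$ be a field. Let $G$ be the abelian group $$G=\langle x_1,\ldots,x_n \mid x_i^{a_{ji}}=x_j^{a_{ij}},\ [x_i,x_j]=1 \text{ for } 1\le i<j\le n\rangle .$$ Suppose $G\cong \mathbb{Z}/r_1\mathbb{Z}\times\cdots\times\mathbb{Z}/r_s\mathbb{Z}\times\mathbb{Z}^{n-s}$ for some positive integers $r_1,\ldots,r_s$ and some $s\in\{0,1,\ldots,n\}$. Then $$K_2(A,F)\cong \frac{K_2(F)}{r_1K_2(F)}\times\cdots\times\frac{K_2(F)}{r_sK_2(F)}\times K_2(F)^{n-s}.$$
   Context: A generalised Cartan matrix (GCM) is a square integer matrix $A=(a_{ij})_{1\le i,j\le n}$ with $a_{ii}=2$, $a_{ij}\le 0$ for $i\ne j$, and $a_{ij}=0$ if and only if $a_{ji}=0$. Let $F$ be a field and $F^*$ its multiplicative group. $K_2$-groups are written multiplicatively. In $G$, $[x_i,x_j]$ denotes the commutator. $K_2(F)$ is the abelian group generated by symbols $\{u,v\}$ ($u,v\in F^*$) with defining relations, for all $t,u,v\in F^*$: (A1) $\{tu,v\}=\{t,v\}\{u,v\}$; (A2) $\{t,uv\}=\{t,u\}\{t,v\}$; (A3) $\{u,1-u\}=1$ if $u\ne 1$. For an integer $r$, $rK_2(F)$ denotes the subgroup $\{g^r: g\in K_2(F)\}$. For an $n\times n$ GCM $A=(a_{ij})$, $K_2(A,F)$ is the abelian group generated by $c_i(u,v)$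 ($1\le i\le n$, $u,v\in F^*$) with defining relations, for all $t,u,v\in F^*$ and $1\le i\ne j\le n$ (for (L1)–(L4), all $1\le i\le n$): (L1) $c_i(t,u)c_i(tu,v)=c_i(t,uv)c_i(u,v)$; (L2) $c_i(1,1)=1$; (L3) $c_i(u,v)=c_i(u^{-1},v^{-1})$; (L4) $c_i(u,v)=c_i(u,(1-u)v)$ if $u\neq 1$; (L5) $c_i(u,v^{a_{ji}})=c_j(u^{a_{ij}},v)$; (L6) $c_i(tu,v^{a_{ji}})=c_i(t,v^{a_{ji}})c_i(u,v^{a_{ji}})$; (L7) $c_i(t^{a_{ji}},uv)=c_i(t^{a_{ji}},u)c_i(t^{a_{ji}},v)$. *)

theory Defs
  imports
    "HOL-Algebra.Free_Abelian_Groups"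
    "HOL-Algebra.Product_Groups"
    "Jordan_Normal_Form.Matrix"
begin

text \<open>The abelian group with generators \<open>X\<close> in which \<open>l = r\<close> is imposed for each \<open>(l, r) \<in> R\<close>.
  The library writes the free abelian group additively: the generator \<open>x\<close> is \<open>frag_of x\<close>, the
  multiplicative words \<open>l r\<close>, \<open>1\<close> and \<open>l\<^sup>m\<close> are \<open>l + r\<close>, \<open>0\<close> and \<open>frag_cmul m l\<close>, and
  the relator of \<open>l = r\<close> is \<open>l - r\<close>. The relations are meant to lie in the free abelian group on
  \<open>X\<close>.\<close>

definition ab_presentation ::
    "'x set \<Rightarrow> (('x \<Rightarrow>\<^sub>0 int) \<times> ('x \<Rightarrow>\<^sub>0 int)) set \<Rightarrow> ('x \<Rightarrow>\<^sub>0 int) set monoid" where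
  "ab_presentation X R =
     free_Abelian_group X Mod generate (free_Abelian_group X) {l - r | l r. (l, r) \<in> R}"

text \<open>The set of all \<open>m\<close>-th powers, written \<open>m G\<close> for an abelian group \<open>G\<close>.\<close>

definition power_subgroup :: "int \<Rightarrow> ('a, 'b) monoid_scheme \<Rightarrow> 'a set" where
  "power_subgroup m G = {g [^]\<^bsub>G\<^esub> m | g. g \<in> carrier G}"

text \<open>Rows and columns of matrices are numbered from \<open>0\<close>.\<close>

definition gen_Cartan_matrix :: "int mat \<Rightarrow> bool" where
  "gen_Cartan_matrix A \<longleftrightarrow>
     square_mat A \<and>
     (\<forall>i<dim_row A. A $$ (i, i) = 2) \<and>
     (\<forall>i<dim_row A. \<forall>j<dim_row A. i \<noteq> j \<longrightarrow>
        A $$ (i, j) \<le> 0 \<and> (A $$ (i, j) = 0 \<longleftrightarrow> A $$ (j, i) = 0))"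

text \<open>No simultaneous permutation of rows and columns makes the matrix block diagonal with two
  nonempty blocks.\<close>

definition indecomposable_mat :: "int mat \<Rightarrow> bool" where
  "indecomposable_mat A \<longleftrightarrow>
     \<not> (\<exists>I J. I \<noteq> {} \<and> J \<noteq> {} \<and> I \<inter> J = {} \<and> I \<union> J = {..<dim_row A} \<and>
           (\<forall>i\<in>I. \<forall>j\<in>J. A $$ (i, j) = 0 \<and> A $$ (j, i) = 0))"

inductive_set K2_rels :: "(('f::field \<times> 'f \<Rightarrow>\<^sub>0 int) \<times> ('f \<times> 'f \<Rightarrow>\<^sub>0 int)) set" where
  A1: "\<lbrakk>t \<noteq> 0; u \<noteq> 0; v \<noteq> 0\<rbrakk>
     \<Longrightarrow> (frag_of (t * u, v), frag_of (t, v) + frag_of (u, v)) \<in> K2_rels"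
| A2: "\<lbrakk>t \<noteq> 0; u \<noteq> 0; v \<noteq> 0\<rbrakk>
     \<Longrightarrow> (frag_of (t, u * v), frag_of (t, u) + frag_of (t, v)) \<in> K2_rels"
| A3: "\<lbrakk>u \<noteq> 0; u \<noteq> 1\<rbrakk> \<Longrightarrow> (frag_of (u, 1 - u), 0) \<in> K2_rels"

definition K2 :: "'f::field itself \<Rightarrow> ('f \<times> 'f \<Rightarrow>\<^sub>0 int) set monoid" where
  "K2 _ = ab_presentation ((UNIV - {0}) \<times> (UNIV - {0})) K2_rels"

text \<open>The generator \<open>c\<^sub>i(u, v)\<close> is indexed by \<open>(i, u, v)\<close>.\<close>

inductive_set K2_mat_rels ::
    "int mat \<Rightarrow> ((nat \<times> 'f::field \<times> 'f \<Rightarrow>\<^sub>0 int) \<times> (nat \<times> 'f \<times> 'f \<Rightarrow>\<^sub>0 int)) set"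
  for A :: "int mat" where
  L1: "\<lbrakk>i < dim_row A; t \<noteq> 0; u \<noteq> 0; v \<noteq> 0\<rbrakk>
     \<Longrightarrow> (frag_of (i, t, u) + frag_of (i, t * u, v), frag_of (i, t, u * v) + frag_of (i, u, v))
         \<in> K2_mat_rels A"
| L2: "i < dim_row A \<Longrightarrow> (frag_of (i, 1, 1), 0) \<in> K2_mat_rels A"
| L3: "\<lbrakk>i < dim_row A; u \<noteq> 0; v \<noteq> 0\<rbrakk>
     \<Longrightarrow> (frag_of (i, u, v), frag_of (i, inverse u, inverse v)) \<in> K2_mat_rels A"
| L4: "\<lbrakk>i < dim_row A; u \<noteq> 0; v \<noteq> 0; u \<noteq> 1\<rbrakk>
     \<Longrightarrow> (frag_of (i, u, v), frag_of (i, u, (1 - u) * v)) \<in> K2_mat_rels A"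
| L5: "\<lbrakk>i < dim_row A; j < dim_row A; i \<noteq> j; u \<noteq> 0; v \<noteq> 0\<rbrakk>
     \<Longrightarrow> (frag_of (i, u, v powi (A $$ (j, i))), frag_of (j, u powi (A $$ (i, j)), v))
         \<in> K2_mat_rels A"
| L6: "\<lbrakk>i < dim_row A; j < dim_row A; i \<noteq> j; t \<noteq> 0; u \<noteq> 0; v \<noteq> 0\<rbrakk>
     \<Longrightarrow> (frag_of (i, t * u, v powi (A $$ (j, i))),
          frag_of (i, t, v powi (A $$ (j, i))) + frag_of (i, u, v powi (A $$ (j, i))))
         \<in> K2_mat_rels A"
| L7: "\<lbrakk>i < dim_row A; j < dim_row A; i \<noteq> j; t \<noteq> 0; u \<noteq> 0; v \<noteq> 0\<rbrakk>
     \<Longrightarrow> (frag_of (i, t powi (A $$ (j, i)), u * v),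
          frag_of (i, t powi (A $$ (j, i)), u) + frag_of (i, t powi (A $$ (j, i)), v))
         \<in> K2_mat_rels A"

definition K2_mat :: "int mat \<Rightarrow> 'f::field itself \<Rightarrow> (nat \<times> 'f \<times> 'f \<Rightarrow>\<^sub>0 int) set monoid" where
  "K2_mat A _ = ab_presentation ({..<dim_row A} \<times> (UNIV - {0}) \<times> (UNIV - {0})) (K2_mat_rels A)"

text \<open>The abelian group on \<open>x\<^sub>i\<close> with relations \<open>x\<^sub>i\<close> to the power \<open>A $$ (j, i)\<close> equals \<open>x\<^sub>j\<close> to the
  power \<open>A $$ (i, j)\<close> for \<open>i < j\<close>. The commutator relations of the \<open>x\<^sub>i\<close> are those of the free
  abelian group.\<close>

definition Cartan_group :: "int mat \<Rightarrow> (nat \<Rightarrow>\<^sub>0 int) set monoid" where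
  "Cartan_group A = ab_presentation {..<dim_row A}
     {(frag_cmul (A $$ (j, i)) (frag_of i), frag_cmul (A $$ (i, j)) (frag_of j)) | i j.
        i < j \<and> j < dim_row A}"

end

theory Submission
  imports Defs
begin

text \<open>A symbol with (L1)--(L4) is bilinear as soon as one argument is a square. If \<open>a\<close> is odd, then
  \<open>v\<^sup>a\<close> is \<open>v\<close> times a square, so an odd entry in column \<open>i\<close> turns (L6) and (L7) into full bilinearity
  of \<open>c\<^sub>i\<close>. Hence \<open>K\<^sub>2(A,F)\<close> consists of one copy of \<open>K\<^sub>2(F)\<close> for each \<open>i\<close>, linked by (L5) alone, which
  says precisely that \<open>K\<^sub>2(A,F)\<close> is the tensor product of \<open>G\<close> and \<open>K\<^sub>2(F)\<close>. The tensor product of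
  \<open>\<int>/r\<close> and \<open>K\<^sub>2(F)\<close> is \<open>K\<^sub>2(F)/rK\<^sub>2(F)\<close>, and tensor products respect finite direct products.\<close>

section \<open>Symplectic symbols\<close>

text \<open>(L6) and (L7) give linearity only when one argument is an \<open>a\<close>-th power,
  with \<open>a\<close> an off-diagonal entry of column \<open>i\<close>. The odd entry cannot be
  the diagonal 2, so it is one of these. Once \<open>c\<^sub>i\<close> is bilinear, (L1)--(L3) hold
  automatically and (L4) becomes the Steinberg relation (A3), so
  \<open>{u,v} -> c\<^sub>i(u,v)\<close> is a homomorphism \<open>k\<^sub>i\<close> on K2(F). Moving
  exponents through the arguments, (L5) says that \<open>k\<^sub>i\<close> to the power
  \<open>A $$ (j, i)\<close> equals \<open>k\<^sub>j\<close> to the power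
  \<open>A $$ (i, j)\<close>. These are the defining relations of G, imposed in the group Hom(K2(F),
  K2(A,F)). Hence \<open>x\<^sub>i -> k\<^sub>i\<close> extends to G, and uncurrying gives a
  bilinear map on G and K2(F). No tensor product is constructed. Both sides of the isomorphism are
  shown to have its universal property, K2(A,F) through the presentation of G and the product
  through the cyclic decomposition, and uniqueness identifies them.\<close>

lemma hom_powi:
  fixes s :: "'f::field \<Rightarrow> 'a"
  assumes "comm_group H"
    and cl: "\<And>u. u \<noteq> 0 \<Longrightarrow> s u \<in> carrier H"
    and mul: "\<And>u v. \<lbrakk>u \<noteq> 0; v \<noteq> 0\<rbrakk> \<Longrightarrow> s (u * v) = s u \<otimes>\<^bsub>H\<^esub> s v"
    and u: "u \<noteq> 0"
  shows "s (u powi k) = s u [^]\<^bsub>H\<^esub> k"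
proof -
  interpret comm_group H by fact
  have s1: "s 1 = \<one>\<^bsub>H\<^esub>"
    using mul[of 1 1] cl[of 1] by simp
  have pow: "s (u ^ n) = s u [^]\<^bsub>H\<^esub> n" for n :: nat
    by (induction n) (use s1 mul u cl m_comm in auto)
  have inv: "s (inverse x) = inv\<^bsub>H\<^esub> s x" if "x \<noteq> 0" for x
    by (rule inv_equality[symmetric]) (use that mul[of "inverse x" x] s1 cl in auto)
  show ?thesis
  proof (cases k rule: int_cases2)
    case (nonneg n)
    then show ?thesis by (simp add: pow int_pow_int)
  next
    case (nonpos n)
    then show ?thesis
      using u cl by (simp add: power_int_minus inv pow int_pow_neg int_pow_int)
  qed
qed

text \<open>These are (L1)--(L4) for one fixed index, Matsumoto's relations for the Steinberg
  symbols of SL2. Everything that does not involve the matrix is derived from them in an arbitrary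
  commutative target.\<close>

locale symplectic_symbol = comm_group H for H :: "('a, 'b) monoid_scheme" (structure) +
  fixes c :: "'f::field \<Rightarrow> 'f \<Rightarrow> 'a"
  assumes closed: "\<lbrakk>u \<noteq> 0; v \<noteq> 0\<rbrakk> \<Longrightarrow> c u v \<in> carrier H"
    and cocycle: "\<lbrakk>t \<noteq> 0; u \<noteq> 0; v \<noteq> 0\<rbrakk> \<Longrightarrow> c t u \<otimes> c (t * u) v = c t (u * v) \<otimes> c u v"
    and one_one: "c 1 1 = \<one>"
    and inverse_inverse: "\<lbrakk>u \<noteq> 0; v \<noteq> 0\<rbrakk> \<Longrightarrow> c u v = c (inverse u) (inverse v)"
    and one_minus: "\<lbrakk>u \<noteq> 0; v \<noteq> 0; u \<noteq> 1\<rbrakk> \<Longrightarrow> c u v = c u ((1 - u) * v)"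
begin

section \<open>Shears and rotation of the two arguments\<close>

lemma one_left: "v \<noteq> 0 \<Longrightarrow> c 1 v = \<one>"
  using cocycle[of 1 1 v] closed[of 1 v] one_one by simp

text \<open>Using (L4) at \<open>inverse u\<close> between two inversions (L3) divides the second
  argument by \<open>1 - inverse u\<close>; using (L4) at \<open>u\<close> multiplies it by
  \<open>1 - u\<close>. The quotient of these factors is \<open>- u\<close>.\<close>

lemma shear_right:
  assumes "u \<noteq> 0" "v \<noteq> 0"
  shows "c u (- u * v) = c u v"
proof (cases "u = 1")
  case False
  have *: "(1 - u) * (inverse (1 - inverse u) * v) = - u * v"
    using assms False by (simp add: field_simps)
  have "c u v = c (inverse u) ((1 - inverse u) * inverse v)"
    using assms False inverse_inverse[of u v] one_minus[of "inverse u" "inverse v"] by simp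
  also have "\<dots> = c u (inverse (1 - inverse u) * v)"
    using assms False inverse_inverse[of "inverse u" "(1 - inverse u) * inverse v"] by simp
  also have "\<dots> = c u (- u * v)"
    unfolding *[symmetric] using assms False by (intro one_minus) auto
  finally show ?thesis ..
qed (use assms one_left in auto)

text \<open>The cocycle identity at \<open>(- v, u, v)\<close> contains both sides, and its two
  other terms agree by \<open>shear_right\<close> at \<open>- v\<close>.\<close>

lemma shear_left:
  assumes "u \<noteq> 0" "v \<noteq> 0"
  shows "c (- u * v) v = c u v"
proof -
  have "c (- v) u \<otimes> c (- v * u) v = c (- v) (u * v) \<otimes> c u v"
    using assms by (intro cocycle) auto
  moreover have "c (- v) (u * v) = c (- v) u"
    using shear_right[of "- v" u] assms by (simp add: mult.commute)
  ultimately show ?thesis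
    using assms by (simp add: closed mult.commute)
qed

text \<open>The two shears generate \<open>SL\<^sub>2(\<int>)\<close> acting on exponents, up to signs; the rotation is a product
  of three of them.\<close>

lemma rotate:
  assumes "u \<noteq> 0" "v \<noteq> 0"
  shows "c u v = c (inverse v) u"
proof -
  have "c (inverse v) u = c (- inverse v * u) u"
    using shear_left[of "inverse v" u] assms by simp
  also have "\<dots> = c (- inverse v * u) v"
    using shear_right[of "- inverse v * u" v] assms by (simp add: field_simps)
  also have "\<dots> = c u v"
    using shear_left[of "- inverse v * u" v] assms by (simp add: field_simps)
  finally show ?thesis ..
qed

text \<open>By (L1), \<open>c\<close> is a 2-cocycle of an abelian group, so the commutator pairing \<open>c(u, v) c(v, u)\<^sup>-\<^sup>1\<close> of
  the corresponding central extension is bilinear. It turns out to be \<open>c(u\<^sup>2, v)\<close>.\<close>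

lemma square_left:
  assumes "u \<noteq> 0" "v \<noteq> 0"
  shows "c (u * u) v \<otimes> c v u = c u v"
proof -
  \<comment> \<open>The cocycle identities at \<open>(u, inverse u, v)\<close> and
    \<open>(u, u, v)\<close> share the terms \<open>c u (- 1)\<close> and \<open>c u (- v)\<close>
    after shearing. Eliminating them leaves \<open>c (u * u) v\<close> times
    \<open>c (inverse u) v\<close>, and the latter is \<open>c v u\<close> by rotation.\<close>
  have 1: "c (inverse u) v \<otimes> c u (- v) = c u (- 1)"
  proof -
    have "c u (inverse u) \<otimes> c (u * inverse u) v = c u (inverse u * v) \<otimes> c (inverse u) v"
      using assms by (intro cocycle) auto
    moreover have "c u (inverse u) = c u (- 1)"
      using shear_right[of u "inverse u"] assms by simp
    moreover have "c u (inverse u * v) = c u (- v)"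
      using shear_right[of u "inverse u * v"] assms by (simp add: field_simps)
    ultimately show ?thesis
      using assms by (simp add: one_left closed m_comm)
  qed
  have 2: "c u (- 1) \<otimes> c (u * u) v = c u (- v) \<otimes> c u v"
  proof -
    have "c u u \<otimes> c (u * u) v = c u (u * v) \<otimes> c u v"
      using assms by (intro cocycle) auto
    moreover have "c u u = c u (- 1)"
      using shear_right[of u "- 1"] assms by simp
    moreover have "c u (u * v) = c u (- v)"
      using shear_right[of u "- v"] assms by simp
    ultimately show ?thesis by simp
  qed
  have cl: "c u (- v) \<in> carrier H" "c (inverse u) v \<in> carrier H" "c (u * u) v \<in> carrier H"
    "c u v \<in> carrier H"
    using assms by (auto intro!: closed)
  have "c u (- v) \<otimes> (c (u * u) v \<otimes> c (inverse u) v) =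
      (c (inverse u) v \<otimes> c u (- v)) \<otimes> c (u * u) v"
    using cl by (simp add: m_ac)
  also have "\<dots> = c u (- v) \<otimes> c u v"
    by (simp only: 1 2)
  finally have "c u (- v) \<otimes> (c (u * u) v \<otimes> c (inverse u) v) = c u (- v) \<otimes> c u v" .
  then have "c (u * u) v \<otimes> c (inverse u) v = c u v"
    using cl by simp
  then show ?thesis
    using rotate[of v u] assms by simp
qed

text \<open>The usual proof that the commutator pairing of a 2-cocycle is multiplicative combines
  three cocycle identities, with \<open>v\<close> in the last, first and middle place. The equations
  \<open>s\<close> write each \<open>c x v\<close> as a pairing value times \<open>c v x\<close>, so
  that no inverses occur in the computation.\<close>

lemma square_mult_left:
  assumes "t \<noteq> 0" "u \<noteq> 0" "v \<noteq> 0"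
  shows "c ((t * u) * (t * u)) v = c (t * t) v \<otimes> c (u * u) v"
proof -
  define b b1 b2 where "b = c ((t * u) * (t * u)) v" and "b1 = c (t * t) v" and "b2 = c (u * u) v"
  have e: "c t u \<otimes> c (t * u) v = c t (u * v) \<otimes> c u v"
    "c v t \<otimes> c (t * v) u = c v (t * u) \<otimes> c t u"
    "c t v \<otimes> c (t * v) u = c t (u * v) \<otimes> c v u"
    using cocycle[of t u v] cocycle[of v t u] cocycle[of t v u] assms by (simp_all add: mult.commute)
  have s: "c (t * u) v = b \<otimes> c v (t * u)" "c t v = b1 \<otimes> c v t" "c u v = b2 \<otimes> c v u"
    using square_left[of "t * u" v] square_left[of t v] square_left[of u v] assms
    by (simp_all add: b_def b1_def b2_def)
  have cl: "b \<in> carrier H" "b1 \<in> carrier H" "b2 \<in> carrier H" "c t u \<in> carrier H"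
    "c t (u * v) \<in> carrier H" "c v t \<in> carrier H" "c (t * v) u \<in> carrier H"
    "c v (t * u) \<in> carrier H" "c v u \<in> carrier H"
    using assms by (auto simp: b_def b1_def b2_def intro!: closed)
  have "(c v t \<otimes> c (t * v) u) \<otimes> b = c t u \<otimes> (b \<otimes> c v (t * u))"
    using cl by (simp add: e(2) m_ac)
  also have "\<dots> = c t (u * v) \<otimes> (b2 \<otimes> c v u)"
    using e(1) by (simp add: s)
  also have "\<dots> = (c t (u * v) \<otimes> c v u) \<otimes> b2"
    using cl by (simp add: m_ac)
  also have "\<dots> = (b1 \<otimes> c v t \<otimes> c (t * v) u) \<otimes> b2"
    using e(3) by (simp add: s)
  also have "\<dots> = (c v t \<otimes> c (t * v) u) \<otimes> (b1 \<otimes> b2)"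
    using cl by (simp add: m_ac)
  finally show ?thesis
    using cl by (simp add: b_def b1_def b2_def)
qed

text \<open>A commutator pairing is antisymmetric: applying \<open>square_left\<close> to
  \<open>(u, v)\<close> and then to \<open>(v, u)\<close> leads back to \<open>c u v\<close>, so the
  two factors picked up cancel.\<close>

lemma square_antisym:
  assumes "u \<noteq> 0" "v \<noteq> 0"
  shows "c (u * u) v = inv c (v * v) u"
proof (rule inv_equality[symmetric])
  have "c u v \<otimes> (c (u * u) v \<otimes> c (v * v) u) = c (u * u) v \<otimes> (c (v * v) u \<otimes> c u v)"
    using assms by (simp add: closed m_ac)
  also have "\<dots> = c u v"
    using assms by (simp add: square_left)
  finally show "c (u * u) v \<otimes> c (v * v) u = \<one>"
    using assms by (simp add: closed)
qed (use assms in \<open>auto intro: closed\<close>)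

lemma square_mult_right:
  assumes "t \<noteq> 0" "u \<noteq> 0" "v \<noteq> 0"
  shows "c (t * t) (u * v) = c (t * t) u \<otimes> c (t * t) v"
proof -
  have "c (t * t) (u * v) = inv (c (u * u) t \<otimes> c (v * v) t)"
    using assms square_antisym[of t "u * v"] square_mult_left[of u v t] by simp
  also have "\<dots> = inv c (u * u) t \<otimes> inv c (v * v) t"
    using assms by (simp add: closed inv_mult)
  also have "\<dots> = c (t * t) u \<otimes> c (t * t) v"
    using assms square_antisym[of t u] square_antisym[of t v] by simp
  finally show ?thesis .
qed

text \<open>Rotation moves the square to the first argument, inverted; multiplicativity of the
  pairing extracts the inverse, and antisymmetry removes it. Facts about squares on the left thereby
  transfer to the right.\<close>

lemma square_right:
  assumes "u \<noteq> 0" "v \<noteq> 0"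
  shows "c u (v * v) = c (u * u) v"
proof -
  have "c u (v * v) = c (inverse v * inverse v) u"
    using rotate[of u "v * v"] assms by simp
  also have "\<dots> = c (u * u) v"
  proof -
    have "c (inverse v * inverse v) u \<otimes> c (v * v) u = \<one>"
      using square_mult_left[of "inverse v" v u] assms by (simp add: one_left)
    then have "c (inverse v * inverse v) u = inv c (v * v) u"
      using assms by (intro inv_equality[symmetric]) (auto intro: closed)
    then show ?thesis using square_antisym[of u v] assms by simp
  qed
  finally show ?thesis .
qed

text \<open>In the cocycle identity at \<open>(u * u, t, v)\<close> the term
  \<open>c (u * u) (t * v)\<close> splits by \<open>square_mult_right\<close>, and
  \<open>c (u * u) t\<close> cancels.\<close>

lemma mult_square_left:
  assumes "t \<noteq> 0" "u \<noteq> 0" "v \<noteq> 0"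
  shows "c (t * (u * u)) v = c t v \<otimes> c (u * u) v"
proof -
  have "c (u * u) t \<otimes> c (u * u * t) v = c (u * u) t \<otimes> c (u * u) v \<otimes> c t v"
    using cocycle[of "u * u" t v] square_mult_right[of u t v] assms by simp
  then have "c (u * u) t \<otimes> c (u * u * t) v = c (u * u) t \<otimes> (c (u * u) v \<otimes> c t v)"
    using assms by (simp add: closed m_assoc)
  then show ?thesis
    using assms by (simp add: closed m_comm mult.commute)
qed

text \<open>Here the cocycle identity is taken at \<open>(t, v * v, u)\<close>, where
  \<open>mult_square_left\<close> splits the symbol with first argument
  \<open>t * (v * v)\<close>.\<close>

lemma mult_square_right:
  assumes "t \<noteq> 0" "u \<noteq> 0" "v \<noteq> 0"
  shows "c t (u * (v * v)) = c t u \<otimes> c t (v * v)"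
proof -
  have "c t (v * v) \<otimes> (c t u \<otimes> c (v * v) u) = c t (v * v * u) \<otimes> c (v * v) u"
    using cocycle[of t "v * v" u] mult_square_left[of t v u] assms by simp
  then have "(c t (v * v) \<otimes> c t u) \<otimes> c (v * v) u = c t (v * v * u) \<otimes> c (v * v) u"
    using assms by (simp add: closed m_assoc)
  then show ?thesis
    using assms by (simp add: closed m_comm mult.commute)
qed

section \<open>From linearity in odd powers to full bilinearity\<close>

lemma odd_powi: "\<exists>k. \<forall>v::'f. v \<noteq> 0 \<longrightarrow> v powi a = v * (v powi k * v powi k)" if odd: "odd a"
proof -
  \<comment> \<open>In the application \<open>a\<close> is an off-diagonal entry, so
    \<open>k\<close> is negative; hence integer powers of nonzero elements.\<close>
  obtain k where "a = 2 * k + 1" using odd by (rule oddE)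
  then have a: "a = 1 + (k + k)" by simp
  have "v powi a = v * (v powi k * v powi k)" if "v \<noteq> 0" for v :: 'f
    unfolding a using that by (simp only: power_int_add power_int_1_right simp_thms)
  then show ?thesis by blast
qed

text \<open>With \<open>v powi a = v * (w * w)\<close>, each symbol in \<open>lin\<close> splits
  into one at \<open>v\<close> and one at \<open>w * w\<close>. The symbol at \<open>w * w\<close>
  is already multiplicative in its first argument, so its contribution cancels.\<close>

lemma mult_left_of_odd_power:
  assumes "odd a"
    and lin: "\<And>t u v. \<lbrakk>t \<noteq> 0; u \<noteq> 0; v \<noteq> 0\<rbrakk> \<Longrightarrow> c (t * u) (v powi a) = c t (v powi a) \<otimes> c u (v powi a)"
    and nz: "t \<noteq> 0" "u \<noteq> 0" "v \<noteq> 0"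
  shows "c (t * u) v = c t v \<otimes> c u v"
proof -
  obtain k where k: "\<And>v::'f. v \<noteq> 0 \<Longrightarrow> v powi a = v * (v powi k * v powi k)"
    using odd_powi[OF assms(1)] by blast
  define w where "w = v powi k"
  have w: "w \<noteq> 0" using nz by (simp add: w_def)
  have exp: "c x (v powi a) = c x v \<otimes> c x (w * w)" if "x \<noteq> 0" for x
    using that nz w by (simp add: k mult_square_right flip: w_def)
  have sq: "c (t * u) (w * w) = c t (w * w) \<otimes> c u (w * w)"
    using nz w square_mult_left[of t u w] by (simp add: square_right)
  have cl: "c t v \<in> carrier H" "c u v \<in> carrier H" "c (t * u) v \<in> carrier H"
    "c t (w * w) \<in> carrier H" "c u (w * w) \<in> carrier H"
    using nz w by (auto intro!: closed)
  have "c (t * u) v \<otimes> (c t (w * w) \<otimes> c u (w * w)) = (c t v \<otimes> c u v) \<otimes> (c t (w * w) \<otimes> c u (w * w))"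
    using lin[OF nz] cl nz by (simp add: exp sq m_ac)
  then show ?thesis using cl by simp
qed

lemma mult_right_of_odd_power:
  assumes "odd a"
    and lin: "\<And>t u v. \<lbrakk>t \<noteq> 0; u \<noteq> 0; v \<noteq> 0\<rbrakk> \<Longrightarrow> c (t powi a) (u * v) = c (t powi a) u \<otimes> c (t powi a) v"
    and nz: "t \<noteq> 0" "u \<noteq> 0" "v \<noteq> 0"
  shows "c t (u * v) = c t u \<otimes> c t v"
proof -
  obtain k where k: "\<And>v::'f. v \<noteq> 0 \<Longrightarrow> v powi a = v * (v powi k * v powi k)"
    using odd_powi[OF assms(1)] by blast
  define w where "w = t powi k"
  have w: "w \<noteq> 0" using nz by (simp add: w_def)
  have exp: "c (t powi a) x = c t x \<otimes> c (w * w) x" if "x \<noteq> 0" for x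
    using that nz w by (simp add: k mult_square_left flip: w_def)
  have sq: "c (w * w) (u * v) = c (w * w) u \<otimes> c (w * w) v"
    using nz w by (simp add: square_mult_right)
  have cl: "c t v \<in> carrier H" "c t u \<in> carrier H" "c t (u * v) \<in> carrier H"
    "c (w * w) u \<in> carrier H" "c (w * w) v \<in> carrier H"
    using nz w by (auto intro!: closed)
  have "c t (u * v) \<otimes> (c (w * w) u \<otimes> c (w * w) v) = (c t u \<otimes> c t v) \<otimes> (c (w * w) u \<otimes> c (w * w) v)"
    using lin[OF nz] cl nz by (simp add: exp sq m_ac)
  then show ?thesis using cl by simp
qed

text \<open>Rotation takes \<open>c u 1\<close> to \<open>c 1 u\<close>, which is trivial, and (L4)
  at second argument 1 carries this to \<open>1 - u\<close>.\<close>

lemma steinberg: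
  assumes mult: "\<And>t u v. \<lbrakk>t \<noteq> 0; u \<noteq> 0; v \<noteq> 0\<rbrakk> \<Longrightarrow> c t (u * v) = c t u \<otimes> c t v"
    and "u \<noteq> 0" "u \<noteq> 1"
  shows "c u (1 - u) = \<one>"
proof -
  have "c u 1 = \<one>"
    using rotate[of u 1] one_left assms by simp
  then show ?thesis using one_minus[of u 1] assms by simp
qed

end

section \<open>Generating sets and products\<close>

lemma hom_eq_on_generate:
  assumes "f \<in> hom G H" "g \<in> hom G H" "group G" "group H" "S \<subseteq> carrier G"
    and "\<And>x. x \<in> S \<Longrightarrow> f x = g x" and "x \<in> generate G S"
  shows "f x = g x"
proof -
  interpret f: group_hom G H f using assms by (simp add: group_hom_def group_hom_axioms_def)
  interpret g: group_hom G H g using assms by (simp add: group_hom_def group_hom_axioms_def)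
  show ?thesis
    using assms(7)
  proof (induction rule: generate.induct)
    case (eng a b)
    then have "a \<in> carrier G" "b \<in> carrier G"
      using assms(5) group.generate_in_carrier[OF assms(3)] by blast+
    then show ?case using eng by simp
  qed (use assms(5,6) in \<open>auto simp: subset_iff\<close>)
qed

lemma comm_group_DirProd:
  assumes "comm_group G" "comm_group H"
  shows "comm_group (G \<times>\<times> H)"
proof -
  interpret G: comm_group G by fact
  interpret H: comm_group H by fact
  show ?thesis
    by (rule group.group_comm_groupI)
      (auto simp: DirProd_group G.is_group H.is_group G.m_comm H.m_comm)
qed

lemma comm_group_product_group:
  assumes "\<And>i. i \<in> I \<Longrightarrow> comm_group (G i)"
  shows "comm_group (product_group I G)"
proof (rule group.group_comm_groupI)
  show "group (product_group I G)"
    using assms by (intro product_group) (rule comm_group.axioms)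
  show "x \<otimes>\<^bsub>product_group I G\<^esub> y = y \<otimes>\<^bsub>product_group I G\<^esub> x"
    if "x \<in> carrier (product_group I G)" "y \<in> carrier (product_group I G)" for x y
  proof -
    have "x i \<otimes>\<^bsub>G i\<^esub> y i = y i \<otimes>\<^bsub>G i\<^esub> x i" if "i \<in> I" for i
    proof -
      interpret comm_group "G i" using assms that by blast
      show ?thesis using \<open>x \<in> _\<close> \<open>y \<in> _\<close> that by (auto intro!: m_comm)
    qed
    then show ?thesis by (auto simp: restrict_def)
  qed
qed

section \<open>Groups given by generators and relations\<close>

abbreviation ab_relators :: "'x set \<Rightarrow> (('x \<Rightarrow>\<^sub>0 int) \<times> ('x \<Rightarrow>\<^sub>0 int)) set \<Rightarrow> ('x \<Rightarrow>\<^sub>0 int) set" where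
  "ab_relators X R \<equiv> generate (free_Abelian_group X) {l - r | l r. (l, r) \<in> R}"

definition ab_class where
  "ab_class X R w = ab_relators X R #>\<^bsub>free_Abelian_group X\<^esub> w"

locale ab_pres =
  fixes X :: "'x set" and R
  assumes rels: "R \<subseteq> carrier (free_Abelian_group X) \<times> carrier (free_Abelian_group X)"
begin

lemma relD:
  assumes "(l, r) \<in> R"
  shows "Poly_Mapping.keys l \<subseteq> X" "Poly_Mapping.keys r \<subseteq> X"
proof -
  have "(l, r) \<in> carrier (free_Abelian_group X) \<times> carrier (free_Abelian_group X)"
    using rels assms by blast
  then show "Poly_Mapping.keys l \<subseteq> X" "Poly_Mapping.keys r \<subseteq> X" by simp_all
qed

lemma relators_closed: "{l - r | l r. (l, r) \<in> R} \<subseteq> carrier (free_Abelian_group X)"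
proof clarsimp
  fix l r x assume "(l, r) \<in> R" "x \<in> Poly_Mapping.keys (l - r)"
  then show "x \<in> X" using relD[of l r] keys_diff[of l r] by blast
qed

lemma subgroup_relators: "subgroup (ab_relators X R) (free_Abelian_group X)"
  using relators_closed by (rule group.generate_is_subgroup[OF group_free_Abelian_group])

lemma normal_relators: "ab_relators X R \<lhd> free_Abelian_group X"
  using comm_group.normal_iff_subgroup[OF abelian_free_Abelian_group] subgroup_relators by blast

lemma comm_group_presentation: "comm_group (ab_presentation X R)"
  unfolding ab_presentation_def
  by (rule comm_group.abelian_FactGroup[OF abelian_free_Abelian_group subgroup_relators])

lemma ab_class_hom: "ab_class X R \<in> hom (free_Abelian_group X) (ab_presentation X R)"
  using normal.r_coset_hom_Mod[OF normal_relators]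
  by (simp add: ab_presentation_def ab_class_def[abs_def])

lemma carrier_presentation: "carrier (ab_presentation X R) = ab_class X R ` carrier (free_Abelian_group X)"
  by (simp add: ab_presentation_def ab_class_def[abs_def] carrier_FactGroup)

lemma ab_class_relation:
  assumes "(l, r) \<in> R"
  shows "ab_class X R l = ab_class X R r"
proof -
  have lr: "l \<in> carrier (free_Abelian_group X)" "r \<in> carrier (free_Abelian_group X)"
    using relD[OF assms] by simp_all
  have "l - r \<in> ab_relators X R"
    using assms by (intro generate.incl) auto
  then have "l \<in> ab_relators X R #>\<^bsub>free_Abelian_group X\<^esub> r"
    by (auto simp: r_coset_def intro!: bexI[of _ "l - r"])
  then show ?thesis
    unfolding ab_class_def
    using group.repr_independence[OF group_free_Abelian_group _ lr(2) subgroup_relators, of l] by simp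
qed

lemma generate_presentation:
  "generate (ab_presentation X R) ((\<lambda>x. ab_class X R (frag_of x)) ` X) = carrier (ab_presentation X R)"
    (is "generate ?P ?S = _")
proof
  interpret P: comm_group ?P by (rule comm_group_presentation)
  interpret h: group_hom "free_Abelian_group X" ?P "ab_class X R"
    by (simp add: group_hom_def group_hom_axioms_def ab_class_hom)
  have S: "?S \<subseteq> carrier ?P" by (auto simp: carrier_presentation)
  show "generate ?P ?S \<subseteq> carrier ?P"
    using S by (rule P.generate_incl)
  have "ab_class X R w \<in> generate ?P ?S" if "Poly_Mapping.keys w \<subseteq> X" for w
    using that
  proof (rule free_Abelian_group_induct)
    show "ab_class X R 0 \<in> generate ?P ?S"
      using h.hom_one generate.one[of ?P ?S] by simp
  next
    fix x y
    assume k: "Poly_Mapping.keys x \<subseteq> X" "Poly_Mapping.keys y \<subseteq> X"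
      and IH: "ab_class X R x \<in> generate ?P ?S" "ab_class X R y \<in> generate ?P ?S"
    have d: "Poly_Mapping.keys (x - y) \<subseteq> X" using k keys_diff[of x y] by blast
    have cl: "ab_class X R x \<in> carrier ?P" "ab_class X R y \<in> carrier ?P"
      "ab_class X R (x - y) \<in> carrier ?P"
      using k d h.hom_closed by simp_all
    \<comment> \<open>The induction on the free group runs over differences, while a homomorphism
      speaks of sums only; so the class of \<open>x - y\<close> is solved for from
      \<open>(x - y) + y = x\<close>.\<close>
    have "ab_class X R x = ab_class X R (x - y) \<otimes>\<^bsub>?P\<^esub> ab_class X R y"
      using h.hom_mult[of "x - y" y] k d by simp
    then have "ab_class X R (x - y) = ab_class X R x \<otimes>\<^bsub>?P\<^esub> inv\<^bsub>?P\<^esub> ab_class X R y"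
      using P.inv_solve_right[of "ab_class X R (x - y)" "ab_class X R x" "ab_class X R y"] cl by simp
    then show "ab_class X R (x - y) \<in> generate ?P ?S"
      using IH P.generate_is_subgroup[OF S] by (simp add: subgroup.m_closed subgroup.m_inv_closed)
  next
    show "ab_class X R (frag_of a) \<in> generate ?P ?S" if "a \<in> X" for a
      using that by (intro generate.incl) auto
  qed
  then show "carrier ?P \<subseteq> generate ?P ?S"
    by (auto simp: carrier_presentation)
qed

text \<open>The extension of \<open>f\<close> to words exists only inside the proof.
  \<open>resp\<close> therefore asks about an arbitrary homomorphism \<open>h\<close> extending
  \<open>f\<close>, which lets a user evaluate both sides of a relation by pushing \<open>h\<close>
  through the word.\<close>

lemma presentation_universal:
  assumes "comm_group H" and "f ` X \<subseteq> carrier H"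
    and resp: "\<And>h l r. \<lbrakk>h \<in> hom (free_Abelian_group X) H; \<And>x. x \<in> X \<Longrightarrow> h (frag_of x) = f x;
        (l, r) \<in> R\<rbrakk> \<Longrightarrow> h l = h r"
  obtains g where "g \<in> hom (ab_presentation X R) H" "\<And>x. x \<in> X \<Longrightarrow> g (ab_class X R (frag_of x)) = f x"
proof -
  interpret H: comm_group H by fact
  obtain h where h: "h \<in> hom (free_Abelian_group X) H" "\<And>x. x \<in> X \<Longrightarrow> h (frag_of x) = f x"
    using H.free_Abelian_group_universal[OF assms(2)] by blast
  interpret h: group_hom "free_Abelian_group X" H h
    by (simp add: group_hom_def group_hom_axioms_def h)
  have "ab_relators X R \<subseteq> kernel (free_Abelian_group X) H h"
  proof (rule group.generate_subgroup_incl[OF group_free_Abelian_group])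
    show "subgroup (kernel (free_Abelian_group X) H h) (free_Abelian_group X)"
      by (rule h.subgroup_kernel)
    show "{l - r |l r. (l, r) \<in> R} \<subseteq> kernel (free_Abelian_group X) H h"
    proof clarify
      fix l r assume lr: "(l, r) \<in> R"
      then have c: "Poly_Mapping.keys l \<subseteq> X" "Poly_Mapping.keys r \<subseteq> X" using relD by blast+
      then have d: "Poly_Mapping.keys (l - r) \<subseteq> X" using keys_diff[of l r] by blast
      have "h (l - r) \<otimes>\<^bsub>H\<^esub> h r = h r"
        using h.hom_mult[of "l - r" r] c d resp[OF h lr] by simp
      then show "l - r \<in> kernel (free_Abelian_group X) H h"
        using c d h.hom_closed by (simp add: kernel_def)
    qed
  qed
  then obtain g where "g \<in> hom (free_Abelian_group X Mod ab_relators X R) H"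
    "\<And>x. x \<in> carrier (free_Abelian_group X) \<Longrightarrow> g (ab_relators X R #>\<^bsub>free_Abelian_group X\<^esub> x) = h x"
    using h.FactGroup_universal_kernel[OF normal_relators] by blast
  with h that show thesis by (simp add: ab_presentation_def ab_class_def)
qed

end

section \<open>Tensor products of abelian groups\<close>

definition bilinear_map where
  "bilinear_map G K H b \<longleftrightarrow>
     (\<forall>g\<in>carrier G. b g \<in> hom K H) \<and> (\<forall>x\<in>carrier K. (\<lambda>g. b g x) \<in> hom G H)"

lemma bilinear_mapD:
  assumes "bilinear_map G K H b"
  shows "g \<in> carrier G \<Longrightarrow> b g \<in> hom K H" "x \<in> carrier K \<Longrightarrow> (\<lambda>g. b g x) \<in> hom G H"
    "g \<in> carrier G \<Longrightarrow> x \<in> carrier K \<Longrightarrow> b g x \<in> carrier H"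
  using assms by (auto simp: bilinear_map_def hom_def)

lemma bilinear_map_comp:
  assumes "bilinear_map G K H b" "f \<in> hom G' G" "h \<in> hom H H'"
  shows "bilinear_map G' K H' (\<lambda>g x. h (b (f g) x))"
  using assms by (auto simp: bilinear_map_def hom_def Pi_iff)

text \<open>Agreement on generators is propagated twice: in the second argument with a generator of
  \<open>G\<close> held fixed, then in the first argument with any element of \<open>K\<close> held
  fixed.\<close>

lemma bilinear_map_eqI:
  assumes b: "bilinear_map G K H b" and b': "bilinear_map G K H b'"
    and grp: "group G" "group K" "group H"
    and S: "generate G S = carrier G" and T: "generate K T = carrier K"
    and eq: "\<And>g x. \<lbrakk>g \<in> S; x \<in> T\<rbrakk> \<Longrightarrow> b g x = b' g x"
    and gx: "g \<in> carrier G" "x \<in> carrier K"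
  shows "b g x = b' g x"
proof -
  have sub: "S \<subseteq> carrier G" "T \<subseteq> carrier K"
    unfolding S[symmetric] T[symmetric] by (auto intro: generate.incl)
  have *: "b g x = b' g x" if "g \<in> S" "x \<in> carrier K" for g x
  proof (rule hom_eq_on_generate[OF _ _ grp(2,3) sub(2)])
    show "b g \<in> hom K H" "b' g \<in> hom K H"
      using bilinear_mapD(1)[OF b] bilinear_mapD(1)[OF b'] sub that by blast+
    show "x \<in> generate K T" using that T by simp
    show "b g y = b' g y" if "y \<in> T" for y using eq \<open>g \<in> S\<close> that by blast
  qed
  show ?thesis
    by (rule hom_eq_on_generate[OF bilinear_mapD(2)[OF b gx(2)] bilinear_mapD(2)[OF b' gx(2)] grp(1,3) sub(1)])
      (use * gx S in auto)
qed

text \<open>This group serves to curry: a homomorphism from \<open>G\<close> into it is a bilinear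
  map on \<open>G\<close> and \<open>K\<close>, so a presentation of \<open>G\<close> yields
  bilinear maps. Its elements are extensional so that homomorphisms agreeing on
  \<open>carrier K\<close> are equal, without which the inverse law would fail.\<close>

definition hom_group :: "('a, 'c) monoid_scheme \<Rightarrow> ('b, 'd) monoid_scheme \<Rightarrow> ('a \<Rightarrow> 'b) monoid" where
  "hom_group K H = \<lparr>carrier = hom K H \<inter> extensional (carrier K),
     monoid.mult = (\<lambda>f g. \<lambda>x\<in>carrier K. f x \<otimes>\<^bsub>H\<^esub> g x), one = (\<lambda>x\<in>carrier K. \<one>\<^bsub>H\<^esub>)\<rparr>"

lemma comm_group_hom_group:
  assumes "group K" "comm_group H"
  shows "comm_group (hom_group K H)"
proof -
  interpret K: group K by fact
  interpret H: comm_group H by fact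
  show ?thesis
  proof (rule comm_groupI)
    fix f assume f: "f \<in> carrier (hom_group K H)"
    show "\<exists>g\<in>carrier (hom_group K H). g \<otimes>\<^bsub>hom_group K H\<^esub> f = \<one>\<^bsub>hom_group K H\<^esub>"
    proof (rule bexI[of _ "\<lambda>x\<in>carrier K. inv\<^bsub>H\<^esub> f x"])
      show "(\<lambda>x\<in>carrier K. inv\<^bsub>H\<^esub> f x) \<in> carrier (hom_group K H)"
        using f by (auto simp: hom_group_def hom_def Pi_iff H.inv_mult)
      show "(\<lambda>x\<in>carrier K. inv\<^bsub>H\<^esub> f x) \<otimes>\<^bsub>hom_group K H\<^esub> f = \<one>\<^bsub>hom_group K H\<^esub>"
        using f by (auto simp: hom_group_def hom_def Pi_iff intro!: restrict_ext)
    qed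
  qed (auto simp: hom_group_def hom_def Pi_iff H.m_ac extensional_def intro!: ext)
qed

lemma hom_group_pow:
  assumes "group K" "comm_group H" "f \<in> carrier (hom_group K H)" "x \<in> carrier K"
  shows "(f [^]\<^bsub>hom_group K H\<^esub> (n::int)) x = f x [^]\<^bsub>H\<^esub> n"
proof -
  have "(\<lambda>f. f x) \<in> hom (hom_group K H) H"
    using assms(4) by (auto simp: hom_def hom_group_def)
  then show ?thesis
    using hom_int_pow[of "\<lambda>f. f x" "hom_group K H" H f n] assms comm_group_hom_group[OF assms(1,2)]
    by (simp add: comm_group.axioms(2))
qed

lemma bilinear_map_hom_group:
  assumes "C \<in> hom G (hom_group K H)"
  shows "bilinear_map G K H C"
  using assms by (auto simp: bilinear_map_def hom_def hom_group_def Pi_iff)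

text \<open>The universal property is stated for one target \<open>H\<close> at a time because a definition cannot
  quantify over the types of all targets.\<close>

definition is_tensor_for where
  "is_tensor_for H G K M C \<longleftrightarrow>
     bilinear_map G K M C \<and>
     carrier M = generate M (\<Union>g\<in>carrier G. C g ` carrier K) \<and>
     (\<forall>b. bilinear_map G K H b \<longrightarrow>
        (\<exists>h\<in>hom M H. \<forall>g\<in>carrier G. \<forall>x\<in>carrier K. h (C g x) = b g x))"

lemma is_tensor_forD:
  assumes "is_tensor_for H G K M C"
  shows "bilinear_map G K M C" "generate M (\<Union>g\<in>carrier G. C g ` carrier K) = carrier M"
  using assms by (simp_all add: is_tensor_for_def)

lemma is_tensor_for_universal:
  assumes "is_tensor_for H G K M C" "bilinear_map G K H b"
  obtains h where "h \<in> hom M H" "\<And>g x. \<lbrakk>g \<in> carrier G; x \<in> carrier K\<rbrakk> \<Longrightarrow> h (C g x) = b g x"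
  using assms unfolding is_tensor_for_def by blast

text \<open>The two induced maps run between \<open>M\<close> and \<open>T\<close>, so each
  universal property is needed for one target only, namely the other group. The isomorphism of
  \<open>G\<close> and \<open>G'\<close> is absorbed by precomposition, and both composites fix the
  pure tensors, which generate.\<close>

lemma tensor_unique:
  assumes M: "is_tensor_for T G K M C" and T: "is_tensor_for M G' K T E"
    and iso: "G \<cong> G'"
    and grp: "group G" "group G'" "group M" "group T"
  shows "M \<cong> T"
proof -
  obtain f where f: "f \<in> iso G G'" using iso by (auto simp: is_iso_def)
  let ?f' = "inv_into (carrier G) f"
  have hf: "f \<in> hom G G'" "?f' \<in> hom G' G"
    using f group.iso_set_sym[OF grp(1) f] by (auto simp: iso_def)
  have ff: "?f' (f g) = g" if "g \<in> carrier G" for g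
    using f that by (simp add: iso_def bij_betw_def)
  have ff': "f (?f' g) = g" if "g \<in> carrier G'" for g
    using f that by (auto simp: iso_def bij_betw_def f_inv_into_f)
  note bM = is_tensor_forD(1)[OF M]
  note bT = is_tensor_forD(1)[OF T]
  have "bilinear_map G K T (\<lambda>g x. E (f g) x)" "bilinear_map G' K M (\<lambda>g x. C (?f' g) x)"
    using bilinear_map_comp[OF bT hf(1), of "\<lambda>x. x" T] bilinear_map_comp[OF bM hf(2), of "\<lambda>x. x" M]
    by (auto simp: hom_def)
  note b = this
  obtain p where p: "p \<in> hom M T" "\<And>g x. \<lbrakk>g \<in> carrier G; x \<in> carrier K\<rbrakk> \<Longrightarrow> p (C g x) = E (f g) x"
    using is_tensor_for_universal[OF M b(1)] by blast
  obtain q where q: "q \<in> hom T M" "\<And>g x. \<lbrakk>g \<in> carrier G'; x \<in> carrier K\<rbrakk> \<Longrightarrow> q (E g x) = C (?f' g) x"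
    using is_tensor_for_universal[OF T b(2)] by blast
  have mem: "f g \<in> carrier G'" if "g \<in> carrier G" for g using that hf by (auto simp: hom_def)
  have mem': "?f' g \<in> carrier G" if "g \<in> carrier G'" for g using that hf by (auto simp: hom_def)
  have "q (p y) = y" if "y \<in> carrier M" for y
  proof -
    have "(\<lambda>y. q (p y)) y = (\<lambda>y. y) y"
    proof (rule hom_eq_on_generate[OF _ _ grp(3,3), of _ _ "\<Union>g\<in>carrier G. C g ` carrier K"])
      show "y \<in> generate M (\<Union>g\<in>carrier G. C g ` carrier K)"
        using M that by (simp add: is_tensor_for_def)
      show "(\<lambda>y. q (p y)) \<in> hom M M"
        using hom_compose[OF p(1) q(1)] by (simp add: comp_def)
      show "q (p y) = y" if "y \<in> (\<Union>g\<in>carrier G. C g ` carrier K)" for y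
        using that by (auto simp: p(2) q(2) mem ff)
    qed (use bilinear_mapD(3)[OF bM] in \<open>auto simp: hom_def\<close>)
    then show ?thesis by simp
  qed
  moreover have "p (q y) = y" if "y \<in> carrier T" for y
  proof -
    have "(\<lambda>y. p (q y)) y = (\<lambda>y. y) y"
    proof (rule hom_eq_on_generate[OF _ _ grp(4,4), of _ _ "\<Union>g\<in>carrier G'. E g ` carrier K"])
      show "y \<in> generate T (\<Union>g\<in>carrier G'. E g ` carrier K)"
        using T that by (simp add: is_tensor_for_def)
      show "(\<lambda>y. p (q y)) \<in> hom T T"
        using hom_compose[OF q(1) p(1)] by (simp add: comp_def)
      show "p (q y) = y" if "y \<in> (\<Union>g\<in>carrier G'. E g ` carrier K)" for y
        using that by (auto simp: p(2) q(2) mem' ff')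
    qed (use bilinear_mapD(3)[OF bT] in \<open>auto simp: hom_def\<close>)
    then show ?thesis by simp
  qed
  ultimately have "group_isomorphisms M T p q"
    using p q by (simp add: group_isomorphisms_def)
  then show ?thesis
    using group_isomorphisms_imp_iso[of M T p q] by (auto simp: is_iso_def)
qed

text \<open>This is for the factors of a direct product: an embedding that takes pure tensors to
  pure tensors takes the whole factor into the subgroup they generate.\<close>

lemma tensor_generate_embedding:
  assumes T: "is_tensor_for H G K M C"
    and grp: "group M" "group M'" and j: "j \<in> hom M M'"
    and i: "\<And>g. g \<in> carrier G \<Longrightarrow> i g \<in> carrier G'"
    and eq: "\<And>g x. \<lbrakk>g \<in> carrier G; x \<in> carrier K\<rbrakk> \<Longrightarrow> j (C g x) = C' (i g) x"
    and y: "y \<in> carrier M"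
  shows "j y \<in> generate M' (\<Union>g\<in>carrier G'. C' g ` carrier K)"
proof -
  let ?S = "\<Union>g\<in>carrier G. C g ` carrier K"
  have "group_hom M M' j" using grp j by (simp add: group_hom_def group_hom_axioms_def)
  moreover have "?S \<subseteq> carrier M" using bilinear_mapD(3)[OF is_tensor_forD(1)[OF T]] by auto
  ultimately have "j ` carrier M = generate M' (j ` ?S)"
    using group_hom.generate_img is_tensor_forD(2)[OF T] by metis
  moreover have "generate M' (j ` ?S) \<subseteq> generate M' (\<Union>g\<in>carrier G'. C' g ` carrier K)"
    using i eq by (intro group.mono_generate[OF grp(2)]) fastforce
  ultimately show ?thesis using y by blast
qed

section \<open>Tensor products with cyclic groups\<close>

lemma is_tensor_for_integer_group:
  assumes "comm_group K" "comm_group H"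
  shows "is_tensor_for H integer_group K K (\<lambda>n x. x [^]\<^bsub>K\<^esub> n)"
proof -
  interpret K: comm_group K by fact
  interpret H: comm_group H by fact
  let ?S = "\<Union>n\<in>carrier (integer_group :: int monoid). (\<lambda>x. x [^]\<^bsub>K\<^esub> n) ` carrier K"
  have "bilinear_map integer_group K K (\<lambda>n x. x [^]\<^bsub>K\<^esub> n)"
    by (auto simp: bilinear_map_def hom_def K.int_pow_distrib K.int_pow_mult)
  moreover have "x \<in> ?S" if "x \<in> carrier K" for x
    using that by (intro UN_I[of 1] image_eqI[of _ _ x]) auto
  then have "carrier K \<subseteq> generate K ?S"
    using generate.incl by (metis subsetI)
  moreover have "generate K ?S \<subseteq> carrier K"
    by (rule K.generate_incl) auto
  moreover have "\<exists>h\<in>hom K H. \<forall>n\<in>carrier integer_group. \<forall>x\<in>carrier K. h (x [^]\<^bsub>K\<^esub> n) = b n x"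
    if b: "bilinear_map integer_group K H b" for b
  proof (intro bexI ballI)
    fix n :: int and x assume x: "x \<in> carrier K"
    \<comment> \<open>The induced map is \<open>b 1\<close>, because \<open>x\<close> is the pure
      tensor of 1 and \<open>x\<close>; linearity in each argument moves the exponent
      \<open>n\<close> from \<open>x\<close> to 1.\<close>
    have "b 1 (x [^]\<^bsub>K\<^esub> n) = b 1 x [^]\<^bsub>H\<^esub> n"
      using x bilinear_mapD(1)[OF b, of 1] hom_int_pow[of "b 1" K H x n] by simp
    also have "\<dots> = b (1 [^]\<^bsub>integer_group\<^esub> n) x"
      using x hom_int_pow[OF bilinear_mapD(2)[OF b x], of 1 n] by simp
    finally show "b 1 (x [^]\<^bsub>K\<^esub> n) = b n x" by simp
  qed (use bilinear_mapD(1)[OF b] in auto)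
  ultimately show ?thesis by (auto simp: is_tensor_for_def)
qed

lemma subgroup_power_subgroup:
  assumes "comm_group G"
  shows "subgroup (power_subgroup m G) G"
proof -
  interpret comm_group G by fact
  have "group_hom G G (\<lambda>g. g [^]\<^bsub>G\<^esub> m)"
    by unfold_locales (auto simp: hom_def int_pow_distrib)
  then have "subgroup ((\<lambda>g. g [^]\<^bsub>G\<^esub> m) ` carrier G) G"
    by (rule group_hom.img_is_subgroup)
  also have "(\<lambda>g. g [^]\<^bsub>G\<^esub> m) ` carrier G = power_subgroup m G"
    by (auto simp: power_subgroup_def)
  finally show ?thesis .
qed

lemma comm_group_Mod_power_subgroup: "comm_group G \<Longrightarrow> comm_group (G Mod power_subgroup m G)"
  by (simp add: comm_group.abelian_FactGroup subgroup_power_subgroup)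

lemma is_tensor_for_integer_mod_group:
  assumes "comm_group K" "comm_group H" "r > 0"
  shows "is_tensor_for H (integer_mod_group r) K (K Mod power_subgroup (int r) K)
    (\<lambda>n x. power_subgroup (int r) K #>\<^bsub>K\<^esub> (x [^]\<^bsub>K\<^esub> n))"
proof -
  interpret K: comm_group K by fact
  interpret H: comm_group H by fact
  let ?N = "power_subgroup (int r) K"
  let ?Q = "K Mod ?N" and ?C = "\<lambda>n x. ?N #>\<^bsub>K\<^esub> (x [^]\<^bsub>K\<^esub> n)"
  let ?Z = "integer_mod_group r"
  let ?S = "\<Union>n\<in>carrier ?Z. ?C n ` carrier K"
  have sN: "subgroup ?N K" using assms(1) by (rule subgroup_power_subgroup)
  have nN: "?N \<lhd> K" using sN by (simp add: K.normal_iff_subgroup)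
  interpret Q: comm_group ?Q using assms(1) by (rule comm_group_Mod_power_subgroup)
  have q: "(\<lambda>x. ?N #>\<^bsub>K\<^esub> x) \<in> hom K ?Q"
    by (rule normal.r_coset_hom_Mod[OF nN])
  have qr: "?N #>\<^bsub>K\<^esub> (x [^]\<^bsub>K\<^esub> (n mod int r)) = ?N #>\<^bsub>K\<^esub> (x [^]\<^bsub>K\<^esub> n)" if "x \<in> carrier K" for x and n :: int
  proof -
    \<comment> \<open>Division with remainder: changing \<open>n\<close> modulo \<open>r\<close>
      changes the power of \<open>x\<close> by an \<open>r\<close>-th power. This makes the map
      linear in \<open>n\<close>, whose sums are reduced modulo \<open>r\<close>.\<close>
    have "x [^]\<^bsub>K\<^esub> n = (x [^]\<^bsub>K\<^esub> (n div int r)) [^]\<^bsub>K\<^esub> int r \<otimes>\<^bsub>K\<^esub> x [^]\<^bsub>K\<^esub> (n mod int r)"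
      using that by (simp add: K.int_pow_pow flip: K.int_pow_mult)
    moreover have "(x [^]\<^bsub>K\<^esub> (n div int r)) [^]\<^bsub>K\<^esub> int r \<in> ?N"
      using that unfolding power_subgroup_def by blast
    ultimately have "x [^]\<^bsub>K\<^esub> n \<in> ?N #>\<^bsub>K\<^esub> (x [^]\<^bsub>K\<^esub> (n mod int r))"
      by (auto simp: r_coset_def)
    then show ?thesis
      using that sN by (intro K.repr_independence) auto
  qed
  have bC: "bilinear_map ?Z K ?Q ?C"
    unfolding bilinear_map_def
  proof (intro conjI ballI homI)
    show "?C n x \<in> carrier ?Q" if "x \<in> carrier K" for n :: int and x
      using hom_in_carrier[OF q, of "x [^]\<^bsub>K\<^esub> n"] that by simp
    show "?C n x \<in> carrier ?Q" if "x \<in> carrier K" for n :: int and x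
      using hom_in_carrier[OF q, of "x [^]\<^bsub>K\<^esub> n"] that by simp
    show "?C n (x \<otimes>\<^bsub>K\<^esub> y) = ?C n x \<otimes>\<^bsub>?Q\<^esub> ?C n y" if "x \<in> carrier K" "y \<in> carrier K" for n :: int and x y
      using that hom_mult[OF q, of "x [^]\<^bsub>K\<^esub> n" "y [^]\<^bsub>K\<^esub> n"] by (simp add: K.int_pow_distrib)
    show "?C (n \<otimes>\<^bsub>?Z\<^esub> m) x = ?C n x \<otimes>\<^bsub>?Q\<^esub> ?C m x" if "x \<in> carrier K" for x and n m :: int
      using that hom_mult[OF q, of "x [^]\<^bsub>K\<^esub> n" "x [^]\<^bsub>K\<^esub> m"] by (simp add: K.int_pow_mult qr)
  qed
  \<comment> \<open>The generator is written \<open>1 mod int r\<close> to cover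
    \<open>r = 1\<close>, where the carrier contains only 0.\<close>
  have one: "1 mod int r \<in> carrier ?Z" using assms(3) by (simp add: carrier_integer_mod_group)
  have "?N #>\<^bsub>K\<^esub> x \<in> ?S" if "x \<in> carrier K" for x
    using that one qr[of x 1] by (intro UN_I[of "1 mod int r"] image_eqI[of _ _ x]) auto
  then have "carrier ?Q \<subseteq> generate ?Q ?S"
    unfolding carrier_FactGroup by (auto intro: generate.incl)
  moreover have "generate ?Q ?S \<subseteq> carrier ?Q"
    using bilinear_mapD(3)[OF bC] by (intro Q.generate_incl) auto
  moreover have "\<exists>h\<in>hom ?Q H. \<forall>n\<in>carrier ?Z. \<forall>x\<in>carrier K. h (?C n x) = b n x"
    if b: "bilinear_map ?Z K H b" for b
  proof -
    let ?f = "b (1 mod int r)"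
    have f: "?f \<in> hom K H" using bilinear_mapD(1)[OF b one] .
    interpret f: group_hom K H ?f by (simp add: group_hom_def group_hom_axioms_def f)
    have pow: "?f (x [^]\<^bsub>K\<^esub> n) = b (n mod int r) x" if x: "x \<in> carrier K" for x and n :: int
    proof -
      have "?f (x [^]\<^bsub>K\<^esub> n) = ?f x [^]\<^bsub>H\<^esub> n"
        using x by (rule f.hom_int_pow)
      also have "\<dots> = b ((1 mod int r) [^]\<^bsub>?Z\<^esub> n) x"
        using hom_int_pow[OF bilinear_mapD(2)[OF b x] one, of n] by simp
      finally show ?thesis by (simp add: int_pow_integer_mod_group mod_mult_right_eq)
    qed
    \<comment> \<open>By \<open>pow\<close>, an \<open>r\<close>-th power is sent to
      \<open>b (int r mod int r) x\<close>, that is \<open>b 0 x\<close>; hence \<open>?f\<close>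
      factors through the quotient.\<close>
    have "b 0 x = \<one>\<^bsub>H\<^esub>" if "x \<in> carrier K" for x
      using hom_one[OF bilinear_mapD(2)[OF b that]] by simp
    then have "?N \<subseteq> kernel K H ?f"
      by (auto simp: power_subgroup_def kernel_def pow)
    then obtain g where g: "g \<in> hom ?Q H" "\<And>x. x \<in> carrier K \<Longrightarrow> g (?N #>\<^bsub>K\<^esub> x) = ?f x"
      using f.FactGroup_universal_kernel[OF nN] by metis
    then show ?thesis
      by (intro bexI[of _ g]) (auto simp: pow carrier_integer_mod_group split: if_splits)
  qed
  ultimately show ?thesis using bC by (auto simp: is_tensor_for_def)
qed

section \<open>Tensor products with finite direct products\<close>

lemma is_tensor_for_DirProd:
  assumes T1: "is_tensor_for H G1 K M1 C1" and T2: "is_tensor_for H G2 K M2 C2"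
    and grp: "comm_group H" "group G1" "group G2" "group K" "comm_group M1" "comm_group M2"
  shows "is_tensor_for H (G1 \<times>\<times> G2) K (M1 \<times>\<times> M2) (\<lambda>(g1, g2) x. (C1 g1 x, C2 g2 x))"
proof -
  interpret H: comm_group H by fact
  interpret G1: group G1 by fact
  interpret G2: group G2 by fact
  interpret K: group K by fact
  interpret M1: comm_group M1 by fact
  interpret M2: comm_group M2 by fact
  let ?G = "G1 \<times>\<times> G2" and ?M = "M1 \<times>\<times> M2" and ?C = "\<lambda>(g1, g2) x. (C1 g1 x, C2 g2 x)"
  let ?S = "\<Union>g\<in>carrier ?G. ?C g ` carrier K"
  have M: "group ?M" by (simp add: DirProd_group)
  note b1 = is_tensor_forD(1)[OF T1]
  note b2 = is_tensor_forD(1)[OF T2]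
  have bC: "bilinear_map ?G K ?M ?C"
    using b1 b2 by (auto simp: bilinear_map_def hom_def Pi_iff)
  have S: "?S \<subseteq> carrier ?M"
    using bilinear_mapD(3)[OF b1] bilinear_mapD(3)[OF b2] by auto
  have C1: "C1 \<one>\<^bsub>G1\<^esub> x = \<one>\<^bsub>M1\<^esub>" and C2: "C2 \<one>\<^bsub>G2\<^esub> x = \<one>\<^bsub>M2\<^esub>" if "x \<in> carrier K" for x
    using hom_one[OF bilinear_mapD(2)[OF b1 that]] hom_one[OF bilinear_mapD(2)[OF b2 that]]
    by auto
  \<comment> \<open>Pure tensors from \<open>(g, 1)\<close> have trivial second component, so the
    first factor of \<open>?M\<close> lies in their span; likewise the second, and the two factors
    generate \<open>?M\<close>.\<close>
  have "(y, \<one>\<^bsub>M2\<^esub>) \<in> generate ?M ?S" if "y \<in> carrier M1" for y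
    using that by (intro tensor_generate_embedding[OF T1 M1.is_group M, of "\<lambda>y. (y, \<one>\<^bsub>M2\<^esub>)" "\<lambda>g. (g, \<one>\<^bsub>G2\<^esub>)"])
      (auto simp: hom_def C2)
  moreover have "(\<one>\<^bsub>M1\<^esub>, y) \<in> generate ?M ?S" if "y \<in> carrier M2" for y
    using that by (intro tensor_generate_embedding[OF T2 M2.is_group M, of "\<lambda>y. (\<one>\<^bsub>M1\<^esub>, y)" "\<lambda>g. (\<one>\<^bsub>G1\<^esub>, g)"])
      (auto simp: hom_def C1)
  ultimately have "(y1, y2) \<in> generate ?M ?S" if "y1 \<in> carrier M1" "y2 \<in> carrier M2" for y1 y2
    using generate.eng[of "(y1, \<one>\<^bsub>M2\<^esub>)" ?M ?S "(\<one>\<^bsub>M1\<^esub>, y2)"] that by simp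
  then have "carrier ?M \<subseteq> generate ?M ?S" by auto
  moreover have "generate ?M ?S \<subseteq> carrier ?M"
    using S by (rule group.generate_incl[OF M])
  moreover have "\<exists>h\<in>hom ?M H. \<forall>g\<in>carrier ?G. \<forall>x\<in>carrier K. h (?C g x) = b g x"
    if b: "bilinear_map ?G K H b" for b
  proof -
    have "bilinear_map G1 K H (\<lambda>g. b (g, \<one>\<^bsub>G2\<^esub>))"
      using bilinear_map_comp[OF b, of "\<lambda>g. (g, \<one>\<^bsub>G2\<^esub>)" G1 "\<lambda>x. x" H] by (simp add: hom_def)
    then obtain h1 where h1: "h1 \<in> hom M1 H"
      "\<And>g x. \<lbrakk>g \<in> carrier G1; x \<in> carrier K\<rbrakk> \<Longrightarrow> h1 (C1 g x) = b (g, \<one>\<^bsub>G2\<^esub>) x"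
      using is_tensor_for_universal[OF T1] by blast
    have "bilinear_map G2 K H (\<lambda>g. b (\<one>\<^bsub>G1\<^esub>, g))"
      using bilinear_map_comp[OF b, of "\<lambda>g. (\<one>\<^bsub>G1\<^esub>, g)" G2 "\<lambda>x. x" H] by (simp add: hom_def)
    then obtain h2 where h2: "h2 \<in> hom M2 H"
      "\<And>g x. \<lbrakk>g \<in> carrier G2; x \<in> carrier K\<rbrakk> \<Longrightarrow> h2 (C2 g x) = b (\<one>\<^bsub>G1\<^esub>, g) x"
      using is_tensor_for_universal[OF T2] by blast
    show ?thesis
    \<comment> \<open>Commutativity of \<open>H\<close> makes this product of the two induced maps a
      homomorphism. It induces \<open>b\<close> because every pair is \<open>(g1, 1)\<close> times
      \<open>(1, g2)\<close>.\<close>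
    proof (rule bexI[of _ "\<lambda>(y1, y2). h1 y1 \<otimes>\<^bsub>H\<^esub> h2 y2"])
      show "(\<lambda>(y1, y2). h1 y1 \<otimes>\<^bsub>H\<^esub> h2 y2) \<in> hom ?M H"
        using h1(1) h2(1) by (auto simp: hom_def Pi_iff H.m_ac)
      show "\<forall>g\<in>carrier ?G. \<forall>x\<in>carrier K. (\<lambda>(y1, y2). h1 y1 \<otimes>\<^bsub>H\<^esub> h2 y2) (?C g x) = b g x"
      proof clarsimp
        fix g1 g2 x assume g: "g1 \<in> carrier G1" "g2 \<in> carrier G2" and x: "x \<in> carrier K"
        have "b ((g1, \<one>\<^bsub>G2\<^esub>) \<otimes>\<^bsub>?G\<^esub> (\<one>\<^bsub>G1\<^esub>, g2)) x = b (g1, \<one>\<^bsub>G2\<^esub>) x \<otimes>\<^bsub>H\<^esub> b (\<one>\<^bsub>G1\<^esub>, g2) x"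
          by (rule hom_mult[OF bilinear_mapD(2)[OF b x]]) (use g in auto)
        then show "h1 (C1 g1 x) \<otimes>\<^bsub>H\<^esub> h2 (C2 g2 x) = b (g1, g2) x"
          using g x by (simp add: h1 h2)
      qed
    qed
  qed
  ultimately show ?thesis using bC by (auto simp: is_tensor_for_def)
qed


lemma hom_product_group_single:
  assumes "\<And>i. i \<in> I \<Longrightarrow> group (G i)" "k \<in> I"
  shows "(\<lambda>y. \<lambda>i\<in>I. if i = k then y else \<one>\<^bsub>G i\<^esub>) \<in> hom (G k) (product_group I G)"
proof (rule homI)
  have one: "\<one>\<^bsub>G i\<^esub> \<in> carrier (G i)" "\<one>\<^bsub>G i\<^esub> \<otimes>\<^bsub>G i\<^esub> \<one>\<^bsub>G i\<^esub> = \<one>\<^bsub>G i\<^esub>" if "i \<in> I" for i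
    using group.is_monoid[OF assms(1)[OF that]] by simp_all
  show "(\<lambda>i\<in>I. if i = k then x else \<one>\<^bsub>G i\<^esub>) \<in> carrier (product_group I G)" if "x \<in> carrier (G k)" for x
    using that one by auto
  show "(\<lambda>i\<in>I. if i = k then x \<otimes>\<^bsub>G k\<^esub> y else \<one>\<^bsub>G i\<^esub>) =
      (\<lambda>i\<in>I. if i = k then x else \<one>\<^bsub>G i\<^esub>) \<otimes>\<^bsub>product_group I G\<^esub>
      (\<lambda>i\<in>I. if i = k then y else \<one>\<^bsub>G i\<^esub>)" for x y
    using one by (auto intro!: restrict_ext)
qed

text \<open>Finiteness of \<open>I\<close> makes every element a product of elements with one
  nontrivial coordinate. This replaces a recursion through binary products.\<close>

lemma product_group_induct:
  assumes "finite I" and grp: "\<And>i. i \<in> I \<Longrightarrow> group (G i)" and y: "y \<in> carrier (product_group I G)"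
    and one: "P \<one>\<^bsub>product_group I G\<^esub>"
    and mult: "\<And>k x z. \<lbrakk>k \<in> I; x \<in> carrier (G k); z \<in> carrier (product_group I G); P z\<rbrakk> \<Longrightarrow>
      P ((\<lambda>i\<in>I. if i = k then x else \<one>\<^bsub>G i\<^esub>) \<otimes>\<^bsub>product_group I G\<^esub> z)"
  shows "P y"
proof -
  have y': "y i \<in> carrier (G i)" if "i \<in> I" for i using y that by auto
  \<comment> \<open>\<open>J\<close> is the set of coordinates already filled in; the others still
    carry the identity.\<close>
  have "P (\<lambda>i\<in>I. if i \<in> J then y i else \<one>\<^bsub>G i\<^esub>)" if "J \<subseteq> I" for J
    using finite_subset[OF that assms(1)] that
  proof (induction rule: finite_induct)
    case empty
    then show ?case using one by (simp add: restrict_def)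
  next
    case (insert k J)
    let ?z = "\<lambda>i\<in>I. if i \<in> J then y i else \<one>\<^bsub>G i\<^esub>"
    have z: "?z \<in> carrier (product_group I G)"
      using y' grp by (auto simp: group.is_monoid)
    have "(\<lambda>i\<in>I. if i = k then y k else \<one>\<^bsub>G i\<^esub>) \<otimes>\<^bsub>product_group I G\<^esub> ?z =
        (\<lambda>i\<in>I. if i \<in> insert k J then y i else \<one>\<^bsub>G i\<^esub>)"
      using insert.hyps y' grp by (auto intro!: restrict_ext simp: group.is_monoid)
    then show ?case
      using mult[of k "y k" ?z] insert.IH insert.prems y' z by (metis insert_subset)
  qed
  from this[of I] have "P (\<lambda>i\<in>I. y i)" by (simp cong: restrict_cong)
  then show ?thesis using y by (simp add: extensional_restrict PiE_iff)
qed

text \<open>As for two factors, single-coordinate pure tensors generate, and the induced map is the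
  finite product over \<open>i\<close> of the maps induced on the factors. Both facts use that
  \<open>I\<close> is finite.\<close>

lemma is_tensor_for_product_group:
  assumes fin: "finite I" and T: "\<And>i. i \<in> I \<Longrightarrow> is_tensor_for H (G i) K (M i) (C i)"
    and H: "comm_group H" and G: "\<And>i. i \<in> I \<Longrightarrow> group (G i)" and K: "group K"
    and M: "\<And>i. i \<in> I \<Longrightarrow> comm_group (M i)"
  shows "is_tensor_for H (product_group I G) K (product_group I M) (\<lambda>g x. \<lambda>i\<in>I. C i (g i) x)"
proof -
  interpret H: comm_group H by fact
  let ?G = "product_group I G" and ?M = "product_group I M" and ?C = "\<lambda>g x. \<lambda>i\<in>I. C i (g i) x"
  let ?S = "\<Union>g\<in>carrier ?G. ?C g ` carrier K"
  have M': "group (M i)" if "i \<in> I" for i using M[OF that] by (rule comm_group.axioms(2))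
  interpret M: group ?M using M' by simp
  note bT = is_tensor_forD(1)[OF T]
  have cl: "C i g x \<in> carrier (M i)" if "i \<in> I" "g \<in> carrier (G i)" "x \<in> carrier K" for i g x
    using bilinear_mapD(3)[OF bT] that by blast
  have one: "C i \<one>\<^bsub>G i\<^esub> x = \<one>\<^bsub>M i\<^esub>" if "i \<in> I" "x \<in> carrier K" for i x
    using hom_one[OF bilinear_mapD(2)[OF bT]] that G M' by blast
  have bC: "bilinear_map ?G K ?M ?C"
    unfolding bilinear_map_def
  proof (intro conjI ballI homI)
    show "?C g x \<in> carrier ?M" if "g \<in> carrier ?G" "x \<in> carrier K" for g x
      using that cl by auto
    show "?C g x \<in> carrier ?M" if "g \<in> carrier ?G" "x \<in> carrier K" for g x
      using that cl by auto
    show "?C g (x \<otimes>\<^bsub>K\<^esub> y) = ?C g x \<otimes>\<^bsub>?M\<^esub> ?C g y" if "g \<in> carrier ?G" "x \<in> carrier K" "y \<in> carrier K" for g x y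
      using that hom_mult[OF bilinear_mapD(1)[OF bT]] by (auto intro!: restrict_ext simp: PiE_iff)
    show "?C (g \<otimes>\<^bsub>?G\<^esub> g') x = ?C g x \<otimes>\<^bsub>?M\<^esub> ?C g' x"
      if "x \<in> carrier K" "g \<in> carrier ?G" "g' \<in> carrier ?G" for g g' x
      using that hom_mult[OF bilinear_mapD(2)[OF bT]] by (auto intro!: restrict_ext simp: PiE_iff)
  qed
  have S: "?S \<subseteq> carrier ?M" by (intro UN_least image_subsetI bilinear_mapD(3)[OF bC])
  let ?e = "\<lambda>N k y. \<lambda>i\<in>I. if i = k then y else \<one>\<^bsub>N i\<^esub>"
  have single: "?e M k y \<in> generate ?M ?S" if "k \<in> I" "y \<in> carrier (M k)" for k y
  proof (rule tensor_generate_embedding[OF T[OF that(1)] M'[OF that(1)] M.is_group _ _ _ that(2),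
        where j = "?e M k" and i = "\<lambda>g. (\<lambda>i\<in>I. if i = k then g else \<one>\<^bsub>G i\<^esub>)"])
    show "?e M k \<in> hom (M k) ?M" by (rule hom_product_group_single[OF _ that(1)]) (rule M')
    show "(\<lambda>i\<in>I. if i = k then g else \<one>\<^bsub>G i\<^esub>) \<in> carrier ?G" if "g \<in> carrier (G k)" for g
      using that G by (auto simp: group.is_monoid)
    show "?e M k (C k g x) = (\<lambda>i\<in>I. C i ((\<lambda>i\<in>I. if i = k then g else \<one>\<^bsub>G i\<^esub>) i) x)"
      if "x \<in> carrier K" for g x
      using that one by (auto intro!: restrict_ext)
  qed
  have "y \<in> generate ?M ?S" if "y \<in> carrier ?M" for y
  proof (rule product_group_induct[OF fin M' that])
    show "\<one>\<^bsub>?M\<^esub> \<in> generate ?M ?S" by (rule generate.one)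
    show "?e M k x \<otimes>\<^bsub>?M\<^esub> z \<in> generate ?M ?S"
      if "k \<in> I" "x \<in> carrier (M k)" "z \<in> generate ?M ?S" for k x z
      using that by (intro generate.eng single)
  qed
  then have "carrier ?M \<subseteq> generate ?M ?S" by auto
  moreover have "generate ?M ?S \<subseteq> carrier ?M"
    using S by (rule M.generate_incl)
  moreover have "\<exists>h\<in>hom ?M H. \<forall>g\<in>carrier ?G. \<forall>x\<in>carrier K. h (?C g x) = b g x"
    if b: "bilinear_map ?G K H b" for b
  proof -
    have "\<exists>h. h \<in> hom (M i) H \<and>
        (\<forall>g\<in>carrier (G i). \<forall>x\<in>carrier K. h (C i g x) = b (?e G i g) x)" if i: "i \<in> I" for i
    proof -
      have bi: "bilinear_map (G i) K H (\<lambda>g. b (?e G i g))"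
        using bilinear_map_comp[OF b hom_product_group_single[OF G i], of "\<lambda>x. x" H] by (simp add: hom_def)
      obtain h where "h \<in> hom (M i) H"
        "\<And>g x. \<lbrakk>g \<in> carrier (G i); x \<in> carrier K\<rbrakk> \<Longrightarrow> h (C i g x) = b (?e G i g) x"
        by (rule is_tensor_for_universal[OF T[OF i] bi]) (rule that)
      then show ?thesis by (intro exI[of _ h] conjI ballI)
    qed
    then have "\<forall>i\<in>I. \<exists>h. h \<in> hom (M i) H \<and>
        (\<forall>g\<in>carrier (G i). \<forall>x\<in>carrier K. h (C i g x) = b (?e G i g) x)" ..
    from bchoice[OF this] obtain h where h': "\<forall>i\<in>I. h i \<in> hom (M i) H \<and>
        (\<forall>g\<in>carrier (G i). \<forall>x\<in>carrier K. h i (C i g x) = b (?e G i g) x)" ..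
    then have h: "\<And>i. i \<in> I \<Longrightarrow> h i \<in> hom (M i) H"
      "\<And>i g x. \<lbrakk>i \<in> I; g \<in> carrier (G i); x \<in> carrier K\<rbrakk> \<Longrightarrow> h i (C i g x) = b (?e G i g) x"
      by simp_all
    let ?h = "\<lambda>y. finprod H (\<lambda>i. h i (y i)) I"
    have hcl: "(\<lambda>i. h i (y i)) \<in> I \<rightarrow> carrier H" if "y \<in> carrier ?M" for y
      using that h(1) by (auto simp: hom_def)
    have hh: "?h \<in> hom ?M H"
    proof (rule homI)
      show "?h y \<in> carrier H" if "y \<in> carrier ?M" for y
        using hcl[OF that] by (rule H.finprod_closed)
      fix y z assume y: "y \<in> carrier ?M" and z: "z \<in> carrier ?M"
      have "?h (y \<otimes>\<^bsub>?M\<^esub> z) = finprod H (\<lambda>i. h i (y i) \<otimes>\<^bsub>H\<^esub> h i (z i)) I"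
        using y z hcl[OF y] hcl[OF z] by (intro H.finprod_cong') (auto simp: hom_mult[OF h(1)] PiE_iff)
      also have "\<dots> = ?h y \<otimes>\<^bsub>H\<^esub> ?h z"
        using hcl[OF y] hcl[OF z] by (rule H.finprod_multf)
      finally show "?h (y \<otimes>\<^bsub>?M\<^esub> z) = ?h y \<otimes>\<^bsub>H\<^esub> ?h z" .
    qed
    have eq: "?h (?C g x) = b g x" if g: "g \<in> carrier ?G" and x: "x \<in> carrier K" for g x
    proof (rule product_group_induct[OF fin G g])
      have "?C \<one>\<^bsub>?G\<^esub> x = \<one>\<^bsub>?M\<^esub>"
        using hom_one[OF bilinear_mapD(2)[OF bC x]] G by simp
      moreover have "b \<one>\<^bsub>?G\<^esub> x = \<one>\<^bsub>H\<^esub>"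
        using hom_one[OF bilinear_mapD(2)[OF b x]] G by simp
      moreover have "?h \<one>\<^bsub>?M\<^esub> = \<one>\<^bsub>H\<^esub>"
        using hom_one[OF hh] by simp
      ultimately show "?h (?C \<one>\<^bsub>?G\<^esub> x) = b \<one>\<^bsub>?G\<^esub> x" by metis
    next
      fix k g' z
      assume mult: "k \<in> I" "g' \<in> carrier (G k)" "z \<in> carrier ?G" "?h (?C z x) = b z x"
      let ?g = "?e G k g'"
      have ge: "?g \<in> carrier ?G"
        using hom_in_carrier[OF hom_product_group_single[of I G k] mult(2)] G mult(1) by simp
      \<comment> \<open>At a coordinate other than \<open>k\<close> the element is the identity, and
        \<open>C i\<close> and \<open>h i\<close> preserve it, so only the factor at
        \<open>k\<close> survives.\<close>
      have "?h (?C ?g x) = finprod H (\<lambda>i. if i = k then b ?g x else \<one>\<^bsub>H\<^esub>) I"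
        using mult x h b ge one hom_one[OF h(1)] M' bilinear_mapD(3)[OF b ge x]
        by (intro H.finprod_cong') auto
      also have "\<dots> = b ?g x"
        using mult(1) fin bilinear_mapD(3)[OF b ge x]
        by (intro H.finprod_singleton_swap[of k I "\<lambda>_. b ?g x"]) auto
      finally have 1: "?h (?C ?g x) = b ?g x" .
      have "?h (?C (?g \<otimes>\<^bsub>?G\<^esub> z) x) = ?h (?C ?g x \<otimes>\<^bsub>?M\<^esub> ?C z x)"
        using hom_mult[OF bilinear_mapD(2)[OF bC x] ge mult(3)] by (rule arg_cong)
      also have "\<dots> = ?h (?C ?g x) \<otimes>\<^bsub>H\<^esub> ?h (?C z x)"
        by (rule hom_mult[OF hh bilinear_mapD(3)[OF bC ge x] bilinear_mapD(3)[OF bC mult(3) x]])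
      also have "\<dots> = b ?g x \<otimes>\<^bsub>H\<^esub> b z x"
        by (simp only: 1 mult(4))
      also have "\<dots> = b (?g \<otimes>\<^bsub>?G\<^esub> z) x"
        by (rule hom_mult[OF bilinear_mapD(2)[OF b x] ge mult(3), symmetric])
      finally show "?h (?C (?g \<otimes>\<^bsub>?G\<^esub> z) x) = b (?g \<otimes>\<^bsub>?G\<^esub> z) x" .
    qed
    show ?thesis by (intro bexI[OF _ hh] ballI eq)
  qed
  ultimately show ?thesis using bC unfolding is_tensor_for_def by blast
qed

section \<open>Evaluating homomorphisms on the words that occur in relations\<close>

lemma hom_frag_of_add:
  assumes "h \<in> hom (free_Abelian_group X) H" "x \<in> X" "y \<in> X"
  shows "h (frag_of x + frag_of y) = h (frag_of x) \<otimes>\<^bsub>H\<^esub> h (frag_of y)"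
  using hom_mult[OF assms(1), of "frag_of x" "frag_of y"] assms(2,3) by simp

lemma hom_frag_zero:
  assumes "h \<in> hom (free_Abelian_group X) H" "group H"
  shows "h 0 = \<one>\<^bsub>H\<^esub>"
  using hom_one[OF assms(1) _ assms(2)] by simp

lemma hom_frag_cmul:
  assumes "h \<in> hom (free_Abelian_group X) H" "group H" "x \<in> X"
  shows "h (frag_cmul k (frag_of x)) = h (frag_of x) [^]\<^bsub>H\<^esub> k"
  using hom_int_pow[OF assms(1) _ _ assms(2), of "frag_of x" k] assms(3) by simp

lemma keys_frag_of_add: "x \<in> X \<Longrightarrow> y \<in> X \<Longrightarrow> Poly_Mapping.keys (frag_of x + frag_of y) \<subseteq> X"
  using keys_add[of "frag_of x" "frag_of y"] by auto

section \<open>Universal properties of the three groups\<close>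

abbreviation K2_gens :: "('f::field \<times> 'f) set" where
  "K2_gens \<equiv> (UNIV - {0}) \<times> (UNIV - {0})"

abbreviation Cartan_rels where
  "Cartan_rels A \<equiv> {(frag_cmul (A $$ (j, i)) (frag_of i), frag_cmul (A $$ (i, j)) (frag_of j)) | i j.
        i < j \<and> j < dim_row A}"

interpretation K2: ab_pres "K2_gens :: ('f::field \<times> 'f) set" K2_rels
proof
  have "(l, r) \<in> carrier (free_Abelian_group K2_gens) \<times> carrier (free_Abelian_group K2_gens)"
    if "(l, r) \<in> K2_rels" for l r :: "'f \<times> 'f \<Rightarrow>\<^sub>0 int"
    using that by cases (simp_all add: keys_frag_of_add)
  then show "(K2_rels :: (('f \<times> 'f \<Rightarrow>\<^sub>0 int) \<times> _) set) \<subseteq> carrier (free_Abelian_group K2_gens) \<times> carrier (free_Abelian_group K2_gens)"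
    by auto
qed

interpretation Cartan: ab_pres "{..<dim_row A}" "Cartan_rels A" for A
  by standard (auto dest!: subsetD[OF keys_cmul])

interpretation K2_mat: ab_pres "{..<dim_row A} \<times> K2_gens" "K2_mat_rels A" for A
proof
  have "(l, r) \<in> carrier (free_Abelian_group ({..<dim_row A} \<times> K2_gens)) \<times>
      carrier (free_Abelian_group ({..<dim_row A} \<times> K2_gens))"
    if "(l, r) \<in> K2_mat_rels A" for l r :: "nat \<times> 'a \<times> 'a \<Rightarrow>\<^sub>0 int"
    using that by cases (simp_all add: keys_frag_of_add)
  then show "(K2_mat_rels A :: ((nat \<times> 'a \<times> 'a \<Rightarrow>\<^sub>0 int) \<times> _) set) \<subseteq>
      carrier (free_Abelian_group ({..<dim_row A} \<times> K2_gens)) \<times> carrier (free_Abelian_group ({..<dim_row A} \<times> K2_gens))"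
    by auto
qed

definition K2_symbol :: "'f::field \<Rightarrow> 'f \<Rightarrow> ('f \<times> 'f \<Rightarrow>\<^sub>0 int) set" where
  "K2_symbol u v = ab_class K2_gens K2_rels (frag_of (u, v))"

definition Cartan_gen :: "int mat \<Rightarrow> nat \<Rightarrow> (nat \<Rightarrow>\<^sub>0 int) set" where
  "Cartan_gen A i = ab_class {..<dim_row A} (Cartan_rels A) (frag_of i)"

definition K2_mat_symbol :: "int mat \<Rightarrow> nat \<Rightarrow> 'f::field \<Rightarrow> 'f \<Rightarrow> (nat \<times> 'f \<times> 'f \<Rightarrow>\<^sub>0 int) set" where
  "K2_mat_symbol A i u v = ab_class ({..<dim_row A} \<times> K2_gens) (K2_mat_rels A) (frag_of (i, u, v))"

lemma comm_group_K2: "comm_group (K2 TYPE('f::field))"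
  unfolding K2_def by (rule K2.comm_group_presentation)

lemma comm_group_Cartan_group: "comm_group (Cartan_group A)"
  unfolding Cartan_group_def by (rule Cartan.comm_group_presentation)

lemma comm_group_K2_mat: "comm_group (K2_mat A TYPE('f::field))"
  unfolding K2_mat_def by (rule K2_mat.comm_group_presentation)

lemma generate_K2:
  "generate (K2 TYPE('f::field)) {K2_symbol u v | u v. u \<noteq> 0 \<and> v \<noteq> 0} = carrier (K2 TYPE('f))"
proof -
  have "{K2_symbol u v | u v :: 'f. u \<noteq> 0 \<and> v \<noteq> 0} = (\<lambda>x. ab_class K2_gens K2_rels (frag_of x)) ` K2_gens"
    by (auto simp: K2_symbol_def)
  then show ?thesis using K2.generate_presentation by (simp add: K2_def)
qed

lemma generate_Cartan_group:
  "generate (Cartan_group A) (Cartan_gen A ` {..<dim_row A}) = carrier (Cartan_group A)"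
  using Cartan.generate_presentation[of A]
  by (simp add: Cartan_gen_def[abs_def] Cartan_group_def)

lemma generate_K2_mat:
  "generate (K2_mat A TYPE('f::field)) {K2_mat_symbol A i u v | i u v. i < dim_row A \<and> u \<noteq> 0 \<and> v \<noteq> 0}
    = carrier (K2_mat A TYPE('f))"
proof -
  have "{K2_mat_symbol A i u v | i (u::'f) v. i < dim_row A \<and> u \<noteq> 0 \<and> v \<noteq> 0} =
      (\<lambda>x. ab_class ({..<dim_row A} \<times> K2_gens) (K2_mat_rels A) (frag_of x)) ` ({..<dim_row A} \<times> K2_gens)"
    by (auto simp: K2_mat_symbol_def image_iff)
  then show ?thesis using K2_mat.generate_presentation[of A] by (simp add: K2_mat_def)
qed

lemma K2_symbol_closed: "\<lbrakk>u \<noteq> 0; v \<noteq> 0\<rbrakk> \<Longrightarrow> K2_symbol u v \<in> carrier (K2 TYPE('f))" for u v :: "'f::field"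
  unfolding generate_K2[symmetric] by (rule generate.incl) blast

lemma Cartan_gen_closed: "i < dim_row A \<Longrightarrow> Cartan_gen A i \<in> carrier (Cartan_group A)"
  unfolding generate_Cartan_group[symmetric] by (rule generate.incl) blast

lemma K2_mat_symbol_closed:
  "\<lbrakk>i < dim_row A; u \<noteq> 0; v \<noteq> 0\<rbrakk> \<Longrightarrow> K2_mat_symbol A i u v \<in> carrier (K2_mat A TYPE('f))" for u v :: "'f::field"
  unfolding generate_K2_mat[symmetric] by (rule generate.incl) blast

lemma K2_symbol_relations:
  fixes t u v :: "'f::field"
  assumes "t \<noteq> 0" "u \<noteq> 0" "v \<noteq> 0"
  shows "K2_symbol (t * u) v = K2_symbol t v \<otimes>\<^bsub>K2 TYPE('f)\<^esub> K2_symbol u v"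
    and "K2_symbol t (u * v) = K2_symbol t u \<otimes>\<^bsub>K2 TYPE('f)\<^esub> K2_symbol t v"
    and "u \<noteq> 1 \<Longrightarrow> K2_symbol u (1 - u) = \<one>\<^bsub>K2 TYPE('f)\<^esub>"
proof -
  have h: "ab_class K2_gens K2_rels \<in> hom (free_Abelian_group K2_gens) (K2 TYPE('f))"
    unfolding K2_def by (rule K2.ab_class_hom)
  show "K2_symbol (t * u) v = K2_symbol t v \<otimes>\<^bsub>K2 TYPE('f)\<^esub> K2_symbol u v"
    using K2.ab_class_relation[OF A1, of t u v] hom_frag_of_add[OF h, of "(t, v)" "(u, v)"] assms
    by (simp add: K2_symbol_def)
  show "K2_symbol t (u * v) = K2_symbol t u \<otimes>\<^bsub>K2 TYPE('f)\<^esub> K2_symbol t v"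
    using K2.ab_class_relation[OF A2, of t u v] hom_frag_of_add[OF h, of "(t, u)" "(t, v)"] assms
    by (simp add: K2_symbol_def)
  show "K2_symbol u (1 - u) = \<one>\<^bsub>K2 TYPE('f)\<^esub>" if "u \<noteq> 1"
    using K2.ab_class_relation[OF A3, of u] hom_frag_zero[OF h comm_group.axioms(2)[OF comm_group_K2]] assms that
    by (simp add: K2_symbol_def)
qed

lemma K2_universal:
  fixes s :: "'f::field \<Rightarrow> 'f \<Rightarrow> 'a"
  assumes "comm_group H"
    and "\<And>u v. \<lbrakk>u \<noteq> 0; v \<noteq> 0\<rbrakk> \<Longrightarrow> s u v \<in> carrier H"
    and "\<And>t u v. \<lbrakk>t \<noteq> 0; u \<noteq> 0; v \<noteq> 0\<rbrakk> \<Longrightarrow> s (t * u) v = s t v \<otimes>\<^bsub>H\<^esub> s u v"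
    and "\<And>t u v. \<lbrakk>t \<noteq> 0; u \<noteq> 0; v \<noteq> 0\<rbrakk> \<Longrightarrow> s t (u * v) = s t u \<otimes>\<^bsub>H\<^esub> s t v"
    and "\<And>u. \<lbrakk>u \<noteq> 0; u \<noteq> 1\<rbrakk> \<Longrightarrow> s u (1 - u) = \<one>\<^bsub>H\<^esub>"
  obtains k where "k \<in> hom (K2 TYPE('f)) H" "\<And>u v. \<lbrakk>u \<noteq> 0; v \<noteq> 0\<rbrakk> \<Longrightarrow> k (K2_symbol u v) = s u v"
proof (rule K2.presentation_universal[OF assms(1), of "\<lambda>(u, v). s u v"])
  fix h :: "('f \<times> 'f \<Rightarrow>\<^sub>0 int) \<Rightarrow> 'a" and l r :: "'f \<times> 'f \<Rightarrow>\<^sub>0 int"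
  assume h: "h \<in> hom (free_Abelian_group K2_gens) H"
    and f: "\<And>x. x \<in> K2_gens \<Longrightarrow> h (frag_of x) = (case x of (u, v) \<Rightarrow> s u v)"
    and "(l, r) \<in> K2_rels"
  from this(3) show "h l = h r"
    by cases
      (use assms in \<open>simp_all add: hom_frag_of_add[OF h] hom_frag_zero[OF h] f comm_group.axioms(2)\<close>)
next
  fix g assume "g \<in> hom (ab_presentation K2_gens K2_rels) H"
    "\<And>x. x \<in> K2_gens \<Longrightarrow> g (ab_class K2_gens K2_rels (frag_of x)) = (case x of (u, v) \<Rightarrow> s u v)"
  then show thesis by (intro that[of g]) (simp_all add: K2_def K2_symbol_def)
qed (use assms in auto)

lemma Cartan_gen_relation:
  assumes "i < dim_row A" "j < dim_row A" "i \<noteq> j"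
  shows "Cartan_gen A i [^]\<^bsub>Cartan_group A\<^esub> (A $$ (j, i)) = Cartan_gen A j [^]\<^bsub>Cartan_group A\<^esub> (A $$ (i, j))"
proof -
  have *: "Cartan_gen A i [^]\<^bsub>Cartan_group A\<^esub> (A $$ (j, i)) = Cartan_gen A j [^]\<^bsub>Cartan_group A\<^esub> (A $$ (i, j))"
    if "i < j" "j < dim_row A" for i j
  proof -
    note h = hom_frag_cmul[OF Cartan.ab_class_hom[of A, folded Cartan_group_def]
        comm_group.axioms(2)[OF comm_group_Cartan_group]]
    have "ab_class {..<dim_row A} (Cartan_rels A) (frag_cmul (A $$ (j, i)) (frag_of i)) =
        ab_class {..<dim_row A} (Cartan_rels A) (frag_cmul (A $$ (i, j)) (frag_of j))"
      using that by (intro Cartan.ab_class_relation) blast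
    then show ?thesis using that by (simp add: h Cartan_gen_def)
  qed
  show ?thesis using assms *[of i j] *[of j i] by (cases "i < j") auto
qed

lemma K2_mat_symbol_relations:
  fixes t u v :: "'f::field"
  assumes "i < dim_row A" "t \<noteq> 0" "u \<noteq> 0" "v \<noteq> 0"
  defines "c \<equiv> K2_mat_symbol A" and "M \<equiv> K2_mat A TYPE('f)"
  shows "c i t u \<otimes>\<^bsub>M\<^esub> c i (t * u) v = c i t (u * v) \<otimes>\<^bsub>M\<^esub> c i u v"
    and "c i 1 (1::'f) = \<one>\<^bsub>M\<^esub>"
    and "c i u v = c i (inverse u) (inverse v)"
    and "u \<noteq> 1 \<Longrightarrow> c i u v = c i u ((1 - u) * v)"
    and "\<lbrakk>j < dim_row A; i \<noteq> j\<rbrakk> \<Longrightarrow> c i u (v powi (A $$ (j, i))) = c j (u powi (A $$ (i, j))) v"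
    and "\<lbrakk>j < dim_row A; i \<noteq> j\<rbrakk> \<Longrightarrow>
      c i (t * u) (v powi (A $$ (j, i))) = c i t (v powi (A $$ (j, i))) \<otimes>\<^bsub>M\<^esub> c i u (v powi (A $$ (j, i)))"
    and "\<lbrakk>j < dim_row A; i \<noteq> j\<rbrakk> \<Longrightarrow>
      c i (t powi (A $$ (j, i))) (u * v) = c i (t powi (A $$ (j, i))) u \<otimes>\<^bsub>M\<^esub> c i (t powi (A $$ (j, i))) v"
proof -
  have h: "ab_class ({..<dim_row A} \<times> K2_gens) (K2_mat_rels A) \<in> hom (free_Abelian_group ({..<dim_row A} \<times> K2_gens)) M"
    unfolding M_def K2_mat_def by (rule K2_mat.ab_class_hom)
  note r = K2_mat.ab_class_relation[of _ _ A, where 'a = 'f]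
  note add = hom_frag_of_add[OF h]
  show "c i t u \<otimes>\<^bsub>M\<^esub> c i (t * u) v = c i t (u * v) \<otimes>\<^bsub>M\<^esub> c i u v"
    using r[OF L1, of i t u v] assms(1-4) by (simp add: add c_def K2_mat_symbol_def)
  show "c i 1 (1::'f) = \<one>\<^bsub>M\<^esub>"
    using r[OF L2, of i] assms(1-4) hom_frag_zero[OF h] comm_group.axioms(2)[OF comm_group_K2_mat[of A, where 'f = 'f]]
    by (simp add: c_def M_def K2_mat_symbol_def)
  show "c i u v = c i (inverse u) (inverse v)"
    using r[OF L3, of i u v] assms(1-4) by (simp add: c_def K2_mat_symbol_def)
  show "c i u v = c i u ((1 - u) * v)" if "u \<noteq> 1"
    using r[OF L4, of i u v] assms(1-4) that by (simp add: c_def K2_mat_symbol_def)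
  assume j: "j < dim_row A" "i \<noteq> j"
  show "c i u (v powi (A $$ (j, i))) = c j (u powi (A $$ (i, j))) v"
    using r[OF L5, of i j u v] assms(1-4) j by (simp add: c_def K2_mat_symbol_def)
  show "c i (t * u) (v powi (A $$ (j, i))) = c i t (v powi (A $$ (j, i))) \<otimes>\<^bsub>M\<^esub> c i u (v powi (A $$ (j, i)))"
    using r[OF L6, of i j t u v] assms(1-4) j by (simp add: add c_def K2_mat_symbol_def)
  show "c i (t powi (A $$ (j, i))) (u * v) = c i (t powi (A $$ (j, i))) u \<otimes>\<^bsub>M\<^esub> c i (t powi (A $$ (j, i))) v"
    using r[OF L7, of i j t u v] assms(1-4) j by (simp add: add c_def K2_mat_symbol_def)
qed

text \<open>For bilinear symbols satisfying the Steinberg relation, (L1)--(L4), (L6) and (L7) are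
  consequences, so (L5) is the only further condition on the family \<open>s\<close>.\<close>

lemma K2_mat_universal:
  fixes s :: "nat \<Rightarrow> 'f::field \<Rightarrow> 'f \<Rightarrow> 'a"
  assumes H: "comm_group H"
    and cl: "\<And>i u v. \<lbrakk>i < dim_row A; u \<noteq> 0; v \<noteq> 0\<rbrakk> \<Longrightarrow> s i u v \<in> carrier H"
    and left: "\<And>i t u v. \<lbrakk>i < dim_row A; t \<noteq> 0; u \<noteq> 0; v \<noteq> 0\<rbrakk> \<Longrightarrow> s i (t * u) v = s i t v \<otimes>\<^bsub>H\<^esub> s i u v"
    and right: "\<And>i t u v. \<lbrakk>i < dim_row A; t \<noteq> 0; u \<noteq> 0; v \<noteq> 0\<rbrakk> \<Longrightarrow> s i t (u * v) = s i t u \<otimes>\<^bsub>H\<^esub> s i t v"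
    and st: "\<And>i u. \<lbrakk>i < dim_row A; u \<noteq> 0; u \<noteq> 1\<rbrakk> \<Longrightarrow> s i u (1 - u) = \<one>\<^bsub>H\<^esub>"
    and link: "\<And>i j u v. \<lbrakk>i < dim_row A; j < dim_row A; i \<noteq> j; u \<noteq> 0; v \<noteq> 0\<rbrakk> \<Longrightarrow>
      s i u (v powi (A $$ (j, i))) = s j (u powi (A $$ (i, j))) v"
  obtains k where "k \<in> hom (K2_mat A TYPE('f)) H"
    "\<And>i u v. \<lbrakk>i < dim_row A; u \<noteq> 0; v \<noteq> 0\<rbrakk> \<Longrightarrow> k (K2_mat_symbol A i u v) = s i u v"
proof -
  interpret H: comm_group H by fact
  have one: "s i 1 1 = \<one>\<^bsub>H\<^esub>" if "i < dim_row A" for i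
  proof -
    have "s i 1 1 \<otimes>\<^bsub>H\<^esub> s i 1 1 = s i 1 1"
      using left[OF that, of 1 1 1] by simp
    then show ?thesis
      using H.l_cancel_one[of "s i 1 1" "s i 1 1"] cl[OF that, of 1 1] by simp
  qed
  \<comment> \<open>Inverting either argument of a bilinear symbol inverts its value; doing both has
    no effect, which is (L3).\<close>
  have inv: "s i u v = s i (inverse u) (inverse v)" if i: "i < dim_row A" and nz: "u \<noteq> 0" "v \<noteq> 0" for i u v
  proof -
    have "s i (inverse u) w = inv\<^bsub>H\<^esub> s i u w" if "w \<noteq> 0" for w
      using hom_powi[OF H, of "\<lambda>u. s i u w" u "-1"] cl[OF i] left[OF i] nz that
      by (simp add: power_int_minus H.int_pow_neg)
    moreover have "s i u (inverse v) = inv\<^bsub>H\<^esub> s i u v"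
      using hom_powi[OF H, of "s i u" v "-1"] cl[OF i] right[OF i] nz
      by (simp add: power_int_minus H.int_pow_neg)
    ultimately show ?thesis using nz cl[OF i nz] by simp
  qed
  show thesis
  proof (rule K2_mat.presentation_universal[OF H, of "\<lambda>(i, u, v). s i u v" A])
    fix h :: "(nat \<times> 'f \<times> 'f \<Rightarrow>\<^sub>0 int) \<Rightarrow> 'a" and l r :: "nat \<times> 'f \<times> 'f \<Rightarrow>\<^sub>0 int"
    assume h: "h \<in> hom (free_Abelian_group ({..<dim_row A} \<times> K2_gens)) H"
      and f: "\<And>x. x \<in> {..<dim_row A} \<times> K2_gens \<Longrightarrow> h (frag_of x) = (case x of (i, u, v) \<Rightarrow> s i u v)"
      and "(l, r) \<in> K2_mat_rels A"
    from this(3) show "h l = h r"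
    proof cases
      case (L1 i t u v)
      then show ?thesis by (simp add: hom_frag_of_add[OF h] f left right cl H.m_ac)
    next
      case (L2 i)
      then show ?thesis by (simp add: hom_frag_zero[OF h] f one)
    next
      case (L3 i u v)
      then show ?thesis using inv[of i u v] by (simp add: f)
    next
      case (L4 i u v)
      then show ?thesis by (simp add: f right st cl)
    next
      case (L5 i j u v)
      then show ?thesis using link[of i j u v] by (simp add: f)
    next
      case (L6 i j t u v)
      then show ?thesis by (simp add: hom_frag_of_add[OF h] f left)
    next
      case (L7 i j t u v)
      then show ?thesis by (simp add: hom_frag_of_add[OF h] f right)
    qed
  next
    fix g assume "g \<in> hom (ab_presentation ({..<dim_row A} \<times> K2_gens) (K2_mat_rels A)) H"
      "\<And>x. x \<in> {..<dim_row A} \<times> K2_gens \<Longrightarrow>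
        g (ab_class ({..<dim_row A} \<times> K2_gens) (K2_mat_rels A) (frag_of x)) = (case x of (i, u, v) \<Rightarrow> s i u v)"
    then show thesis by (intro that[of g]) (simp_all add: K2_mat_def K2_mat_symbol_def)
  qed (use cl in auto)
qed

section \<open>The tensor product decomposition\<close>

lemma K2_mat_symbol_bilinear:
  fixes t u v :: "'f::field"
  assumes A: "gen_Cartan_matrix A" and j: "j < dim_row A" "odd (A $$ (j, i))"
    and i: "i < dim_row A" and nz: "t \<noteq> 0" "u \<noteq> 0" "v \<noteq> 0"
  defines "c \<equiv> K2_mat_symbol A" and "M \<equiv> K2_mat A TYPE('f)"
  shows "c i (t * u) v = c i t v \<otimes>\<^bsub>M\<^esub> c i u v"
    and "c i t (u * v) = c i t u \<otimes>\<^bsub>M\<^esub> c i t v"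
    and "u \<noteq> 1 \<Longrightarrow> c i u (1 - u) = \<one>\<^bsub>M\<^esub>"
proof -
  \<comment> \<open>The diagonal entry 2 is even, so the odd entry lies off the diagonal, where (L6)
    and (L7) are available.\<close>
  have ij: "i \<noteq> j" using A j i by (auto simp: gen_Cartan_matrix_def)
  note rel = K2_mat_symbol_relations[OF i, where 'f = 'f, folded c_def M_def]
  interpret symplectic_symbol M "c i"
    unfolding symplectic_symbol_def symplectic_symbol_axioms_def
  proof (intro conjI allI impI)
    show "comm_group M" unfolding M_def by (rule comm_group_K2_mat)
    show "c i u v \<in> carrier M" if "u \<noteq> 0" "v \<noteq> 0" for u v
      unfolding c_def M_def by (rule K2_mat_symbol_closed[OF i that])
    show "c i 1 1 = \<one>\<^bsub>M\<^esub>"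
      by (rule rel(2)[where t = 1 and u = 1 and v = 1]) simp_all
    show "c i t u \<otimes>\<^bsub>M\<^esub> c i (t * u) v = c i t (u * v) \<otimes>\<^bsub>M\<^esub> c i u v"
      if "t \<noteq> 0" "u \<noteq> 0" "v \<noteq> 0" for t u v
      using that by (rule rel(1))
    show "c i u v = c i (inverse u) (inverse v)" if "u \<noteq> 0" "v \<noteq> 0" for u v
      using one_neq_zero that by (rule rel(3))
    show "c i u v = c i u ((1 - u) * v)" if "u \<noteq> 0" "v \<noteq> 0" "u \<noteq> 1" for u v
      using one_neq_zero that by (rule rel(4))
  qed
  have right: "c i t (u * v) = c i t u \<otimes>\<^bsub>M\<^esub> c i t v" if "t \<noteq> 0" "u \<noteq> 0" "v \<noteq> 0" for t u v
    using j(2) rel(7)[OF _ _ _ j(1) ij] that by (rule mult_right_of_odd_power)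
  show "c i t (u * v) = c i t u \<otimes>\<^bsub>M\<^esub> c i t v"
    using nz by (rule right)
  show "c i (t * u) v = c i t v \<otimes>\<^bsub>M\<^esub> c i u v"
    using j(2) rel(6)[OF _ _ _ j(1) ij] nz by (rule mult_left_of_odd_power)
  show "c i u (1 - u) = \<one>\<^bsub>M\<^esub>" if "u \<noteq> 1"
    using right nz(2) that by (rule steinberg)
qed

text \<open>The map \<open>C\<close> sends the pair of \<open>Cartan_gen A i\<close> and
  \<open>K2_symbol u v\<close> to \<open>K2_mat_symbol A i u v\<close>. It is built by currying,
  from the presentation of G into the group of homomorphisms on K2(F).\<close>

lemma is_tensor_for_K2_mat:
  assumes A: "gen_Cartan_matrix A" and odd: "\<And>i. i < dim_row A \<Longrightarrow> \<exists>j<dim_row A. odd (A $$ (j, i))"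
    and H: "comm_group H"
  obtains C where "is_tensor_for H (Cartan_group A) (K2 TYPE('f::field)) (K2_mat A TYPE('f)) C"
proof -
  let ?G = "Cartan_group A" and ?K = "K2 TYPE('f)" and ?M = "K2_mat A TYPE('f)"
  let ?c = "K2_mat_symbol A :: nat \<Rightarrow> 'f \<Rightarrow> 'f \<Rightarrow> _" and ?s = "K2_symbol :: 'f \<Rightarrow> 'f \<Rightarrow> _"
  interpret G: comm_group ?G by (rule comm_group_Cartan_group)
  interpret K: comm_group ?K by (rule comm_group_K2)
  interpret M: comm_group ?M by (rule comm_group_K2_mat)
  interpret H: comm_group H by fact
  interpret KM: comm_group "hom_group ?K ?M"
    using K.is_group M.comm_group_axioms by (rule comm_group_hom_group)
  let ?S = "{?s u v | u v. u \<noteq> 0 \<and> v \<noteq> 0}"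
  have S: "?S \<subseteq> carrier ?K" by (auto intro: K2_symbol_closed)
  have left: "?c i (t * u) v = ?c i t v \<otimes>\<^bsub>?M\<^esub> ?c i u v"
    and right: "?c i t (u * v) = ?c i t u \<otimes>\<^bsub>?M\<^esub> ?c i t v"
    and st: "u \<noteq> 1 \<Longrightarrow> ?c i u (1 - u) = \<one>\<^bsub>?M\<^esub>"
    if i: "i < dim_row A" and nz: "t \<noteq> 0" "u \<noteq> 0" "v \<noteq> 0" for i t u v
    using odd[OF i] K2_mat_symbol_bilinear[OF A _ _ i nz] by blast+
  note cl = K2_mat_symbol_closed[of _ A, where 'f = 'f]
  have "\<exists>k. k \<in> hom ?K ?M \<and> (\<forall>u v. u \<noteq> 0 \<longrightarrow> v \<noteq> 0 \<longrightarrow> k (?s u v) = ?c i u v)" if i: "i < dim_row A" for i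
  proof -
    show ?thesis
    proof (rule K2_universal[OF M.comm_group_axioms, of "?c i"])
      show "?c i u v \<in> carrier ?M" if "u \<noteq> 0" "v \<noteq> 0" for u v
        by (rule cl[OF i that])
      show "?c i (t * u) v = ?c i t v \<otimes>\<^bsub>?M\<^esub> ?c i u v" if "t \<noteq> 0" "u \<noteq> 0" "v \<noteq> 0" for t u v
        by (rule left[OF i that])
      show "?c i t (u * v) = ?c i t u \<otimes>\<^bsub>?M\<^esub> ?c i t v" if "t \<noteq> 0" "u \<noteq> 0" "v \<noteq> 0" for t u v
        by (rule right[OF i that])
      show "?c i u (1 - u) = \<one>\<^bsub>?M\<^esub>" if "u \<noteq> 0" "u \<noteq> 1" for u
        by (rule st[OF i one_neq_zero that(1) one_neq_zero that(2)])
      fix k assume "k \<in> hom ?K ?M" "\<And>u v. \<lbrakk>u \<noteq> 0; v \<noteq> 0\<rbrakk> \<Longrightarrow> k (?s u v) = ?c i u v"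
      then show ?thesis by blast
    qed
  qed
  then obtain k' where k': "\<And>i. i < dim_row A \<Longrightarrow> k' i \<in> hom ?K ?M"
    "\<And>i u v. \<lbrakk>i < dim_row A; u \<noteq> 0; v \<noteq> 0\<rbrakk> \<Longrightarrow> k' i (?s u v) = ?c i u v"
    by metis
  \<comment> \<open>Restriction makes these homomorphisms extensional, hence elements of
    \<open>hom_group\<close>.\<close>
  define k where "k i = restrict (k' i) (carrier ?K)" for i
  have kc: "k i \<in> carrier (hom_group ?K ?M)" if "i < dim_row A" for i
    using k'(1)[OF that] by (auto simp: k_def hom_group_def hom_def)
  have ks: "k i (?s u v) = ?c i u v" if "i < dim_row A" "u \<noteq> 0" "v \<noteq> 0" for i u v
    using k'(2)[OF that] K2_symbol_closed[OF that(2,3)] by (simp add: k_def)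
  \<comment> \<open>On a symbol, linearity moves the outer exponent into \<open>v\<close>, (L5)
    exchanges it for an exponent on \<open>u\<close> with index \<open>j\<close>, and linearity
    moves that one out again.\<close>
  have link: "k i [^]\<^bsub>hom_group ?K ?M\<^esub> (A $$ (j, i)) = k j [^]\<^bsub>hom_group ?K ?M\<^esub> (A $$ (i, j))"
    (is "?p = ?q") if i: "i < dim_row A" and j: "j < dim_row A" and ij: "i \<noteq> j" for i j
  proof -
    have pq: "?p \<in> carrier (hom_group ?K ?M)" "?q \<in> carrier (hom_group ?K ?M)"
      using kc i j by simp_all
    have "?p x = ?q x" if x: "x \<in> carrier ?K" for x
    proof (rule hom_eq_on_generate[OF _ _ K.is_group M.is_group S])
      show "?p \<in> hom ?K ?M" "?q \<in> hom ?K ?M" using pq by (simp_all add: hom_group_def)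
      show "x \<in> generate ?K ?S" using x by (simp add: generate_K2)
      fix y assume "y \<in> ?S"
      then obtain u v where y: "y = ?s u v" and nz: "u \<noteq> 0" "v \<noteq> 0" by blast
      have yc: "y \<in> carrier ?K" using K2_symbol_closed[OF nz] y by simp
      have "?p y = ?c i u v [^]\<^bsub>?M\<^esub> (A $$ (j, i))"
        using hom_group_pow[OF K.is_group M.comm_group_axioms kc[OF i] yc] ks[OF i nz] y by simp
      also have "\<dots> = ?c i u (v powi (A $$ (j, i)))"
        using nz cl[OF i] right[OF i] by (intro hom_powi[OF M.comm_group_axioms, symmetric]) auto
      also have "\<dots> = ?c j (u powi (A $$ (i, j))) v"
        using K2_mat_symbol_relations(5)[OF i _ nz j ij] nz by blast
      also have "\<dots> = ?c j u v [^]\<^bsub>?M\<^esub> (A $$ (i, j))"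
        using nz cl[OF j] left[OF j] by (intro hom_powi[OF M.comm_group_axioms, of "\<lambda>u. ?c j u v"]) auto
      also have "\<dots> = ?q y"
        using hom_group_pow[OF K.is_group M.comm_group_axioms kc[OF j] yc] ks[OF j nz] y by simp
      finally show "?p y = ?q y" .
    qed
    then show ?thesis
      using pq by (intro extensionalityI[of ?p "carrier ?K" ?q]) (auto simp: hom_group_def)
  qed
  \<comment> \<open>By \<open>link\<close>, the \<open>k i\<close> satisfy the defining relations of
    the Cartan group, so the assignment extends to all of it.\<close>
  obtain C where Ch: "C \<in> hom ?G (hom_group ?K ?M)"
    and Cg: "\<And>i. i < dim_row A \<Longrightarrow> C (Cartan_gen A i) = k i"
  proof (rule Cartan.presentation_universal[OF KM.comm_group_axioms, of k A])
    show "k ` {..<dim_row A} \<subseteq> carrier (hom_group ?K ?M)" using kc by auto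
    show "h l = h r" if h: "h \<in> hom (free_Abelian_group {..<dim_row A}) (hom_group ?K ?M)"
      and hk: "\<And>i. i \<in> {..<dim_row A} \<Longrightarrow> h (frag_of i) = k i" and lr: "(l, r) \<in> Cartan_rels A" for h l r
    proof -
      obtain i j where ij: "l = frag_cmul (A $$ (j, i)) (frag_of i)"
        "r = frag_cmul (A $$ (i, j)) (frag_of j)" "i < j" "j < dim_row A"
        using lr by blast
      then show ?thesis
        using link[of i j] by (simp add: hom_frag_cmul[OF h KM.is_group] hk)
    qed
  next
    fix g assume "g \<in> hom (ab_presentation {..<dim_row A} (Cartan_rels A)) (hom_group ?K ?M)"
      "\<And>i. i \<in> {..<dim_row A} \<Longrightarrow> g (ab_class {..<dim_row A} (Cartan_rels A) (frag_of i)) = k i"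
    then show thesis by (intro that[of g]) (simp_all add: Cartan_group_def Cartan_gen_def)
  qed
  have bC: "bilinear_map ?G ?K ?M C" using Ch by (rule bilinear_map_hom_group)
  have Cs: "C (Cartan_gen A i) (?s u v) = ?c i u v" if "i < dim_row A" "u \<noteq> 0" "v \<noteq> 0" for i u v
    using that by (simp add: Cg ks)
  let ?U = "\<Union>g\<in>carrier ?G. C g ` carrier ?K"
  have "?c i u v \<in> ?U" if "i < dim_row A" "u \<noteq> 0" "v \<noteq> 0" for i u v
    using Cs[OF that] Cartan_gen_closed[OF that(1)] K2_symbol_closed[OF that(2,3)] by force
  then have "carrier ?M \<subseteq> generate ?M ?U"
    unfolding generate_K2_mat[symmetric] by (intro M.mono_generate) blast
  moreover have "?U \<subseteq> carrier ?M"
    by (intro UN_least image_subsetI bilinear_mapD(3)[OF bC])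
  then have "generate ?M ?U \<subseteq> carrier ?M" by (rule M.generate_incl)
  moreover have "\<exists>h\<in>hom ?M H. \<forall>g\<in>carrier ?G. \<forall>x\<in>carrier ?K. h (C g x) = b g x"
    if b: "bilinear_map ?G ?K H b" for b
  proof -
    \<comment> \<open>Conversely, the values of \<open>b\<close> on generators form a family to
      which \<open>K2_mat_universal\<close> applies: bilinearity and the Steinberg relation come
      from K2(F), and the link (L5) from the relation between two generators of G.\<close>
    let ?b = "\<lambda>i u v. b (Cartan_gen A i) (?s u v)"
    have bcl: "?b i u v \<in> carrier H" if "i < dim_row A" "u \<noteq> 0" "v \<noteq> 0" for i u v
      using bilinear_mapD(3)[OF b Cartan_gen_closed K2_symbol_closed] that by blast
    have bh: "b (Cartan_gen A i) \<in> hom ?K H" if "i < dim_row A" for i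
      using bilinear_mapD(1)[OF b Cartan_gen_closed[OF that]] .
    have bleft: "?b i (t * u) v = ?b i t v \<otimes>\<^bsub>H\<^esub> ?b i u v"
      and bright: "?b i t (u * v) = ?b i t u \<otimes>\<^bsub>H\<^esub> ?b i t v"
      if i: "i < dim_row A" and nz: "t \<noteq> 0" "u \<noteq> 0" "v \<noteq> 0" for i t u v
      using K2_symbol_relations[OF nz] hom_mult[OF bh[OF i]] nz by (simp_all add: K2_symbol_closed)
    have bst: "?b i u (1 - u) = \<one>\<^bsub>H\<^esub>" if i: "i < dim_row A" and "u \<noteq> 0" "u \<noteq> 1" for i u
      using K2_symbol_relations(3)[of 1 u 1] that hom_one[OF bh[OF i] K.is_group H.is_group] by simp
    have blink: "?b i u (v powi (A $$ (j, i))) = ?b j (u powi (A $$ (i, j))) v"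
      if i: "i < dim_row A" and j: "j < dim_row A" and ij: "i \<noteq> j" and nz: "u \<noteq> 0" "v \<noteq> 0" for i j u v
    proof -
      note pow = hom_int_pow[OF bilinear_mapD(2)[OF b K2_symbol_closed[OF nz]] _ G.is_group H.is_group]
      have "?b i u (v powi (A $$ (j, i))) = ?b i u v [^]\<^bsub>H\<^esub> (A $$ (j, i))"
        using nz bcl[OF i] bright[OF i] by (intro hom_powi[OF H, of "?b i u"]) auto
      also have "\<dots> = b (Cartan_gen A i [^]\<^bsub>?G\<^esub> (A $$ (j, i))) (?s u v)"
        using pow[OF Cartan_gen_closed[OF i]] by simp
      also have "\<dots> = b (Cartan_gen A j [^]\<^bsub>?G\<^esub> (A $$ (i, j))) (?s u v)"
        using Cartan_gen_relation[OF i j ij] by simp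
      also have "\<dots> = ?b j u v [^]\<^bsub>H\<^esub> (A $$ (i, j))"
        using pow[OF Cartan_gen_closed[OF j]] by simp
      also have "\<dots> = ?b j (u powi (A $$ (i, j))) v"
        using nz bcl[OF j] bleft[OF j] by (intro hom_powi[OF H, of "\<lambda>u. ?b j u v", symmetric]) auto
      finally show ?thesis .
    qed
    obtain h where h: "h \<in> hom ?M H"
      "\<And>i u v. \<lbrakk>i < dim_row A; u \<noteq> 0; v \<noteq> 0\<rbrakk> \<Longrightarrow> h (?c i u v) = ?b i u v"
      using K2_mat_universal[OF H, of A ?b, OF bcl bleft bright bst blink] by blast
    have "h (C g x) = b g x" if "g \<in> carrier ?G" "x \<in> carrier ?K" for g x
    proof (rule bilinear_map_eqI[OF _ b G.is_group K.is_group H.is_group generate_Cartan_group generate_K2 _ that])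
      show "bilinear_map ?G ?K H (\<lambda>g x. h (C g x))"
        using bilinear_map_comp[OF bC, of "\<lambda>g. g" ?G h H] h(1) by (simp add: hom_def)
      show "h (C g x) = b g x" if "g \<in> Cartan_gen A ` {..<dim_row A}" "x \<in> ?S" for g x
        using that by (auto simp: Cs h(2))
    qed
    then show ?thesis using h(1) by blast
  qed
  ultimately have "is_tensor_for H ?G ?K ?M C"
    using bC unfolding is_tensor_for_def by blast
  then show thesis by (rule that)
qed

theorem theorem5p1:
  fixes A :: "int mat" and n s :: nat and r :: "nat \<Rightarrow> nat"
  assumes "A \<in> carrier_mat n n"
    and "gen_Cartan_matrix A"
    and "indecomposable_mat A"
    and "\<forall>j<n. \<exists>i<n. odd (A $$ (i, j))"
    and "s \<le> n"
    and "\<forall>k<s. r k > 0"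
    and "Cartan_group A \<cong>
           product_group {..<s} (\<lambda>k. integer_mod_group (r k))
             \<times>\<times> product_group {..<n - s} (\<lambda>_. integer_group)"
  shows "K2_mat A TYPE('f::field) \<cong>
           product_group {..<s} (\<lambda>k. K2 TYPE('f) Mod power_subgroup (int (r k)) (K2 TYPE('f)))
             \<times>\<times> product_group {..<n - s} (\<lambda>_. K2 TYPE('f))"
    (is "?M \<cong> ?T")
proof -
  let ?K = "K2 TYPE('f)"
  note K = comm_group_K2[where 'f = 'f] and M = comm_group_K2_mat[of A, where 'f = 'f]
  note grp = comm_group.axioms(2)
  have T1: "comm_group (product_group {..<s} (\<lambda>k. ?K Mod power_subgroup (int (r k)) ?K))"
    and T2: "comm_group (product_group {..<n - s} (\<lambda>_. ?K))"
    using K by (auto intro!: comm_group_product_group comm_group_Mod_power_subgroup)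
  then have T: "comm_group ?T" by (rule comm_group_DirProd)
  have G1: "group (product_group {..<s} (\<lambda>k. integer_mod_group (r k)))"
    and G2: "group (product_group {..<n - s} (\<lambda>_. integer_group :: int monoid))"
    by simp_all
  \<comment> \<open>The universal property of \<open>?M\<close> is taken for the target
    \<open>?T\<close>, and those of the two factors of \<open>?T\<close> for the target
    \<open>?M\<close>, as \<open>tensor_unique\<close> demands.\<close>
  obtain C where "is_tensor_for ?T (Cartan_group A) ?K ?M C"
    using is_tensor_for_K2_mat[OF assms(2) _ T] assms(1,4) by auto
  moreover have "is_tensor_for ?M (product_group {..<s} (\<lambda>k. integer_mod_group (r k))) ?K
      (product_group {..<s} (\<lambda>k. ?K Mod power_subgroup (int (r k)) ?K))
      (\<lambda>g x. \<lambda>k\<in>{..<s}. power_subgroup (int (r k)) ?K #>\<^bsub>?K\<^esub> (x [^]\<^bsub>?K\<^esub> g k))"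
    using assms(6) K M grp[OF K]
    by (intro is_tensor_for_product_group is_tensor_for_integer_mod_group)
      (auto intro: comm_group_Mod_power_subgroup)
  moreover have "is_tensor_for ?M (product_group {..<n - s} (\<lambda>_. integer_group)) ?K
      (product_group {..<n - s} (\<lambda>_. ?K)) (\<lambda>g x. \<lambda>k\<in>{..<n - s}. x [^]\<^bsub>?K\<^esub> g k)"
    using K M grp[OF K] by (intro is_tensor_for_product_group is_tensor_for_integer_group) auto
  ultimately show ?thesis
    using tensor_unique is_tensor_for_DirProd[OF _ _ M G1 G2 grp[OF K] T1 T2]
      assms(7) grp[OF comm_group_Cartan_group] DirProd_group[OF G1 G2] grp[OF M] grp[OF T]
    by blast
qed

end
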